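(* Let $f\in L^2(\Omega)$, assume that the characteristic functions $\chi_\epsilon$ of $\Omega^\epsilon$ satisfy $\chi_\epsilon\rightharpoonup\mathcal{X}$ weakly$^*$ in $L^\infty(\Omega)$ as $\epsilon\to0$, and assume that $\lambda_1^\epsilon\ge c>0$ with $c$ independent of $\epsilon$. Let $\{u^\epsilon\}_{\epsilon>0}$ be a family of solutions of $$f(x)=\int_{\mathbb{R}^N\setminus A^\epsilon}J(x-y)\,(u^\epsilon(y)-u^\epsilon(x))\,dy,\quad x\in\Omega^\epsilon,\qquad u^\epsilon(x)\equiv0,\quad x\in\mathbb{R}^N\setminus\Omega.$$ Then there exists $u^*\in L^2(\Omega)$ such that $\tilde u^\epsilon\rightharpoonup u^*$ weakly in $L^2(\Omega)$ as $\epsilon\to0$. (i) If $\mathcal{X}=0$ in $L^\infty(\mathbb{R}^N)$ and there is $m$ with $\int_{\mathbb{R}^N\setminus\Omega}J(x-y)\,dy\ge m>0$ for all $x\in\Omega$, then $u^*(x)=0$ a.e. in $\mathbb{R}^N$. (ii) If $\mathcal{X}\ne0$ in $L^\infty(\mathbb{R}^N)$, then $u^*$ satisfies the following nonlocal problem in $\Omega$: $$\mathcal{X}(x)f(x)=\mathcal{X}(x)\int_{\mathbb{R}^N}J(x-y)\,(u^*(y)-u^*(x))\,dy-\Lambda(x)\,u^*(x)\quad\text{for a.e. }x\in\Omega,$$ with $u^*(x)\equiv0$ for $x\in\mathbb{R}^N\setminus\Omega$, where $\Lambda\in L^\infty(\Omega)$ is given by $$\Lambda(x)=\int_{\mathbb{R}^N}J(x-y)\,(1-\chi_\Omega(y)+\mathcal{X}(y))\,dy-\mathcal{X}(x),\quad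 x\in\Omega,$$ and $\chi_\Omega$ is the characteristic function of $\Omega$.
   Context: $\Omega\subset\mathbb{R}^N$ is a fixed open bounded domain, $\{\Omega^\epsilon\}_{\epsilon>0}$ is a family of open bounded sets with $\Omega^\epsilon\subset\Omega$, and $A^\epsilon=\Omega\setminus\Omega^\epsilon$. $\chi_\epsilon$ is the characteristic function of $\Omega^\epsilon$. $\mathcal{X}\in L^\infty(\mathbb{R}^N)$ satisfies $0\le\mathcal{X}\le1$ and $\mathcal{X}=0$ in $\mathbb{R}^N\setminus\Omega$. Weak$^*$ convergence means $\int_\Omega\chi_\epsilon\varphi\,dx\to\int_\Omega\mathcal{X}\varphi\,dx$ for all $\varphi\in L^1(\Omega)$. The kernel $J\in\mathcal{C}(\mathbb{R}^N,\mathbb{R})$ is non-negative, compactly supported, $J(0)>0$, $J(-x)=J(x)$ for all $x$, and $\int_{\mathbb{R}^N}J(x)\,dx=1$. Set $$W_\epsilon=\{u\in L^2(\mathbb{R}^N\setminus A^\epsilon):u(x)\equiv0,\ x\in\mathbb{R}^N\setminus\Omega\},$$ $$\lambda_1^\epsilon=\inf_{u\in W_\epsilon,\ u\neq0}\frac{\frac12\int_{\mathbb{R}^N\setminus A^\epsilon}\int_{\mathbb{R}^N\setminus A^\epsilon}J(x-y)(u(y)-u(x))^2\,dy\,dx}{\int_{\Omega^\epsilon}u^2(x)\,dx}.$$ Solutions $u^\epsilon$ belong to $W_\epsilon$ and satisfy the equation a.e. in $\Omega^\epsilon$. The tilde denotes extension by zero of functions defined on subsets of $\mathbb{R}^N$.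 *)

theory Defs
  imports "HOL-Analysis.Analysis"
begin

text \<open>
  Elements of a Lebesgue space over a set \<open>S\<close> are represented by functions on the whole space
  whose values outside \<open>S\<close> are irrelevant; equality in such a space is equality almost
  everywhere with respect to \<open>lebesgue_on S\<close>.
\<close>

definition L2_on :: "'a::euclidean_space set \<Rightarrow> ('a \<Rightarrow> real) set" where
  "L2_on S = {u. u \<in> borel_measurable (lebesgue_on S) \<and> integrable (lebesgue_on S) (\<lambda>x. (u x)\<^sup>2)}"

definition Linf_on :: "'a::euclidean_space set \<Rightarrow> ('a \<Rightarrow> real) set" where
  "Linf_on S = {u. u \<in> borel_measurable (lebesgue_on S) \<and>
                   (\<exists>C. AE x in lebesgue_on S. \<bar>u x\<bar> \<le> C)}"

definition zero_ext :: "'a set \<Rightarrow> ('a \<Rightarrow> real) \<Rightarrow> 'a \<Rightarrow> real" where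
  "zero_ext S u x = (if x \<in> S then u x else 0)"

definition weak_star_Linf ::
    "'a::euclidean_space set \<Rightarrow> (real \<Rightarrow> 'a \<Rightarrow> real) \<Rightarrow> ('a \<Rightarrow> real) \<Rightarrow> bool" where
  "weak_star_Linf S v w \<longleftrightarrow>
     (\<forall>\<phi>. integrable (lebesgue_on S) \<phi> \<longrightarrow>
        ((\<lambda>\<epsilon>. LINT x|lebesgue_on S. v \<epsilon> x * \<phi> x) \<longlongrightarrow> (LINT x|lebesgue_on S. w x * \<phi> x)) (at_right 0))"

definition weak_L2 ::
    "'a::euclidean_space set \<Rightarrow> (real \<Rightarrow> 'a \<Rightarrow> real) \<Rightarrow> ('a \<Rightarrow> real) \<Rightarrow> bool" where
  "weak_L2 S v w \<longleftrightarrow>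
     (\<forall>\<phi>\<in>L2_on S.
        ((\<lambda>\<epsilon>. LINT x|lebesgue_on S. v \<epsilon> x * \<phi> x) \<longlongrightarrow> (LINT x|lebesgue_on S. w x * \<phi> x)) (at_right 0))"

text \<open>
  In the following, \<open>O\<^sub>\<epsilon>\<close> is the perforated set, so that \<open>\<Omega> - O\<^sub>\<epsilon>\<close> is the set of holes and
  \<open>- (\<Omega> - O\<^sub>\<epsilon>)\<close> is the complement of the holes in the whole space.
\<close>

definition W_space :: "'a::euclidean_space set \<Rightarrow> 'a set \<Rightarrow> ('a \<Rightarrow> real) set" where
  "W_space \<Omega> O\<^sub>\<epsilon> = {u \<in> L2_on (- (\<Omega> - O\<^sub>\<epsilon>)). AE x in lebesgue_on (- \<Omega>). u x = 0}"

text \<open>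
  The infimum is taken in the extended reals, so that it is \<open>\<infinity>\<close> when \<open>O\<^sub>\<epsilon>\<close> is empty and there is
  no nonzero competitor. For every competitor the denominator is positive.
\<close>

definition lambda1 :: "('a::euclidean_space \<Rightarrow> real) \<Rightarrow> 'a set \<Rightarrow> 'a set \<Rightarrow> ereal" where
  "lambda1 J \<Omega> O\<^sub>\<epsilon> =
     (INF u \<in> {u \<in> W_space \<Omega> O\<^sub>\<epsilon>. \<not> (AE x in lebesgue_on (- (\<Omega> - O\<^sub>\<epsilon>)). u x = 0)}.
        ereal ((1/2 * (LINT x|lebesgue_on (- (\<Omega> - O\<^sub>\<epsilon>)).
                         LINT y|lebesgue_on (- (\<Omega> - O\<^sub>\<epsilon>)). J (x - y) * (u y - u x)\<^sup>2))
               / (LINT x|lebesgue_on O\<^sub>\<epsilon>. (u x)\<^sup>2)))"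

definition is_solution ::
    "('a::euclidean_space \<Rightarrow> real) \<Rightarrow> ('a \<Rightarrow> real) \<Rightarrow> 'a set \<Rightarrow> 'a set \<Rightarrow> ('a \<Rightarrow> real) \<Rightarrow> bool" where
  "is_solution J f \<Omega> O\<^sub>\<epsilon> u \<longleftrightarrow>
     u \<in> W_space \<Omega> O\<^sub>\<epsilon> \<and>
     (AE x in lebesgue_on O\<^sub>\<epsilon>.
        f x = (LINT y|lebesgue_on (- (\<Omega> - O\<^sub>\<epsilon>)). J (x - y) * (u y - u x)))"

definition Lam :: "('a::euclidean_space \<Rightarrow> real) \<Rightarrow> 'a set \<Rightarrow> ('a \<Rightarrow> real) \<Rightarrow> 'a \<Rightarrow> real" where
  "Lam J \<Omega> X x = (LINT y|lebesgue. J (x - y) * (1 - indicator \<Omega> y + X y)) - X x"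

end

theory Submission
  imports Defs "HOL-Complex_Analysis.Great_Picard"
begin

text \<open>
  Write \<open>p\<close> for the indicator of the perforated set, \<open>T w = J * w\<close>, \<open>v\<close> for the extended solution
  and \<open>h p\<close> for the mass of \<open>J (x - _)\<close> outside the holes. The equation reads
  \<open>p f = p T v - h p v\<close>. The eigenvalue bound says that
  \<open>c \<integral> p \<phi>\<^sup>2 \<le> \<integral> p \<phi>\<^sup>2 h p - \<integral> p \<phi> T (p \<phi>)\<close> for all square-integrable \<open>\<phi>\<close>; it bounds \<open>v\<close> in \<open>L\<^sup>2\<close>,
  and testing with indicators of sets where \<open>h p\<close> is small it gives \<open>h p \<ge> c\<close> wherever \<open>p\<close> is
  nonzero. Hence \<open>v = p (T v - f) / max (h p) c\<close>. Along a subsequence \<open>T v\<close> converges pointwise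
  by Arzela-Ascoli, and \<open>h p\<close> converges because \<open>p\<close> does weakly, so \<open>v\<close> converges weakly to a
  solution of the same equation with \<open>p\<close> replaced by \<open>X\<close>; no weak compactness of \<open>L\<^sup>2\<close> is needed.
  The coercivity inequality passes to the weak limit \<open>X\<close>, which makes the limit solution unique.
  Therefore the whole family converges, and the limit vanishes where \<open>X\<close> does.
\<close>

subsection \<open>Square-integrable functions and weak limits of weights\<close>

definition L2 :: "'a measure \<Rightarrow> ('a \<Rightarrow> real) set" where
  "L2 M = {u. u \<in> borel_measurable M \<and> integrable M (\<lambda>x. (u x)\<^sup>2)}"

lemma L2_on_eq: "L2_on S = L2 (lebesgue_on S)"
  by (simp add: L2_on_def L2_def)

lemma L2_measurable [measurable_dest]: "u \<in> L2 M \<Longrightarrow> u \<in> borel_measurable M"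
  by (simp add: L2_def)

lemma L2_integrable_square: "u \<in> L2 M \<Longrightarrow> integrable M (\<lambda>x. (u x)\<^sup>2)"
  by (simp add: L2_def)

lemma L2_integrable_mult:
  assumes "u \<in> L2 M" "v \<in> L2 M"
  shows "integrable M (\<lambda>x. u x * v x)"
proof (rule Bochner_Integration.integrable_bound)
  show "integrable M (\<lambda>x. (u x)\<^sup>2 + (v x)\<^sup>2)"
    using assms by (simp add: L2_integrable_square)
  show "(\<lambda>x. u x * v x) \<in> borel_measurable M"
    using assms by (auto dest!: L2_measurable)
  have "\<bar>u x * v x\<bar> \<le> (u x)\<^sup>2 + (v x)\<^sup>2" for x
  proof -
    have "2 * (\<bar>u x\<bar> * \<bar>v x\<bar>) \<le> (u x)\<^sup>2 + (v x)\<^sup>2"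
      using sum_squares_bound[of "\<bar>u x\<bar>" "\<bar>v x\<bar>"] by simp
    moreover have "0 \<le> \<bar>u x\<bar> * \<bar>v x\<bar>" by simp
    ultimately show ?thesis unfolding abs_mult by linarith
  qed
  then show "AE x in M. norm (u x * v x) \<le> norm ((u x)\<^sup>2 + (v x)\<^sup>2)" by simp
qed

lemma L2_dominated:
  assumes "u \<in> L2 M" "v \<in> borel_measurable M" "AE x in M. \<bar>v x\<bar> \<le> C * \<bar>u x\<bar>"
  shows "v \<in> L2 M"
proof -
  have "integrable M (\<lambda>x. (v x)\<^sup>2)"
  proof (rule Bochner_Integration.integrable_bound)
    show "integrable M (\<lambda>x. C\<^sup>2 * (u x)\<^sup>2)" using assms(1) by (simp add: L2_integrable_square)
    show "AE x in M. norm ((v x)\<^sup>2) \<le> norm (C\<^sup>2 * (u x)\<^sup>2)"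
      using assms(3)
    proof eventually_elim
      case (elim x)
      then have "\<bar>v x\<bar>\<^sup>2 \<le> (C * \<bar>u x\<bar>)\<^sup>2" by (rule power_mono) simp
      then show ?case by (simp add: power_mult_distrib)
    qed
  qed (use assms(2) in simp)
  then show ?thesis using assms(2) by (simp add: L2_def)
qed

lemma L2_add:
  assumes "u \<in> L2 M" "v \<in> L2 M"
  shows "(\<lambda>x. u x + v x) \<in> L2 M"
proof -
  have "integrable M (\<lambda>x. (u x)\<^sup>2 + 2 * (u x * v x) + (v x)\<^sup>2)"
    using assms L2_integrable_mult[OF assms] by (simp add: L2_integrable_square)
  moreover have "(u x)\<^sup>2 + 2 * (u x * v x) + (v x)\<^sup>2 = (u x + v x)\<^sup>2" for x
    by (simp add: power2_sum)
  ultimately show ?thesis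
    using assms by (auto simp: L2_def)
qed

lemma L2_uminus: "u \<in> L2 M \<Longrightarrow> (\<lambda>x. - u x) \<in> L2 M"
  by (auto simp: L2_def)

lemma L2_diff: "u \<in> L2 M \<Longrightarrow> v \<in> L2 M \<Longrightarrow> (\<lambda>x. u x - v x) \<in> L2 M"
  using L2_add[of u M "\<lambda>x. - v x"] L2_uminus[of v M] by simp

text \<open>The bounds hold everywhere rather than almost everywhere, so that estimates such as
  \<open>weight_mult_le\<close> are pointwise and carry no null sets along.\<close>

definition weight :: "'a measure \<Rightarrow> ('a \<Rightarrow> real) \<Rightarrow> bool" where
  "weight M p \<longleftrightarrow> p \<in> borel_measurable M \<and> (\<forall>x. 0 \<le> p x \<and> p x \<le> 1)"

lemma weightD:
  assumes "weight M p"
  shows weight_measurable: "p \<in> borel_measurable M" and "0 \<le> p x" "p x \<le> 1" "\<bar>p x\<bar> \<le> 1"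
  using assms by (auto simp: weight_def)

lemma weight_mult_le:
  assumes "weight M p"
  shows "\<bar>p x * r\<bar> \<le> \<bar>r\<bar>"
  using mult_right_mono[OF weightD(4)[OF assms, of x], of "\<bar>r\<bar>"] by (simp add: abs_mult)

lemma integrable_weight_mult:
  assumes "weight M p" "integrable M g"
  shows "integrable M (\<lambda>x. p x * g x)"
  by (rule Bochner_Integration.integrable_bound[OF assms(2)])
    (use assms weight_mult_le[OF assms(1)] in \<open>auto dest: weightD(1)\<close>)

lemma L2_weight_mult:
  assumes "weight M p" "u \<in> L2 M"
  shows "(\<lambda>x. p x * u x) \<in> L2 M"
  by (rule L2_dominated[OF assms(2), of _ 1])
    (use assms weight_mult_le[OF assms(1)] in \<open>auto dest: weightD(1) L2_measurable\<close>)

text \<open>Weak* convergence in L-infinity along a sequence, tested against L1.\<close>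

definition wlim :: "'a measure \<Rightarrow> (nat \<Rightarrow> 'a \<Rightarrow> real) \<Rightarrow> ('a \<Rightarrow> real) \<Rightarrow> bool" where
  "wlim M p q \<longleftrightarrow> (\<forall>\<psi>. integrable M \<psi> \<longrightarrow>
     (\<lambda>n. LINT x|M. p n x * \<psi> x) \<longlonglongrightarrow> (LINT x|M. q x * \<psi> x))"

text \<open>Split \<open>p n * F n\<close> into \<open>p n * (F n - G)\<close> and
  \<open>p n * G\<close>. Weights are at most one and \<open>F n - G\<close> tends to zero in L1 by
  dominated convergence, so the first part vanishes; the second is weak convergence tested with
  \<open>G\<close>. Limits of products of two varying factors are taken this way below.\<close>

lemma wlim_mult_tendsto:
  assumes p: "\<And>n. weight M (p n)" and pq: "wlim M p q"
    and F: "\<And>n. F n \<in> borel_measurable M" "\<And>x. x \<in> space M \<Longrightarrow> (\<lambda>n. F n x) \<longlonglongrightarrow> G x"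
    and bd: "\<And>n x. x \<in> space M \<Longrightarrow> \<bar>F n x\<bar> \<le> D x" "integrable M D"
  shows "(\<lambda>n. LINT x|M. p n x * F n x) \<longlonglongrightarrow> (LINT x|M. q x * G x)"
proof -
  note [measurable] = F(1)
  have Gm[measurable]: "G \<in> borel_measurable M"
    using borel_measurable_LIMSEQ_real[OF F(2) F(1)] by blast
  have FI: "integrable M (F n)" for n
    by (rule Bochner_Integration.integrable_bound[OF bd(2)]) (use F bd(1) in \<open>auto intro!: AE_I2 order_trans[OF bd(1)]\<close>)
  have GI: "integrable M G"
    by (rule integrable_dominated_convergence[OF Gm F(1) bd(2)]) (use F bd in \<open>auto intro!: AE_I2\<close>)
  have "(\<lambda>n. LINT x|M. \<bar>F n x - G x\<bar>) \<longlonglongrightarrow> (LINT x|M. 0)"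
  proof (rule integral_dominated_convergence[of _ _ _ "\<lambda>x. D x + \<bar>G x\<bar>"])
    show "AE x in M. (\<lambda>i. \<bar>F i x - G x\<bar>) \<longlonglongrightarrow> 0"
      using F(2) by (auto intro!: AE_I2 tendsto_rabs_zero simp: LIM_zero)
    show "AE x in M. norm \<bar>F i x - G x\<bar> \<le> D x + \<bar>G x\<bar>" for i
      using bd(1)[of _ i] by (auto intro!: AE_I2) (smt (verit))
  qed (use bd GI in auto)
  then have lim0: "(\<lambda>n. LINT x|M. \<bar>F n x - G x\<bar>) \<longlonglongrightarrow> 0" by simp
  have "(\<lambda>n. LINT x|M. p n x * (F n x - G x)) \<longlonglongrightarrow> 0"
  proof (rule Lim_null_comparison[OF _ lim0], rule always_eventually, rule allI)
    fix n
    have I: "integrable M (\<lambda>x. F n x - G x)" using FI GI by simp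
    have "norm (LINT x|M. p n x * (F n x - G x)) \<le> (LINT x|M. \<bar>p n x * (F n x - G x)\<bar>)"
      using integral_abs_bound by simp
    also have "\<dots> \<le> (LINT x|M. \<bar>F n x - G x\<bar>)"
      using integrable_weight_mult[OF p I] I weight_mult_le[OF p] by (intro integral_mono) auto
    finally show "norm (LINT x|M. p n x * (F n x - G x)) \<le> (LINT x|M. \<bar>F n x - G x\<bar>)" .
  qed
  moreover have "(\<lambda>n. LINT x|M. p n x * G x) \<longlonglongrightarrow> (LINT x|M. q x * G x)"
    using pq GI by (simp add: wlim_def)
  ultimately have "(\<lambda>n. (LINT x|M. p n x * (F n x - G x)) + (LINT x|M. p n x * G x))
      \<longlonglongrightarrow> 0 + (LINT x|M. q x * G x)" by (rule tendsto_add)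
  moreover have "(LINT x|M. p n x * (F n x - G x)) + (LINT x|M. p n x * G x) = (LINT x|M. p n x * F n x)" for n
    using integrable_weight_mult[OF p, of "F n" n] integrable_weight_mult[OF p, of G n] FI GI
    by (simp add: right_diff_distrib)
  ultimately show ?thesis by simp
qed

subsection \<open>Weighted nonlocal equations on a finite measure space\<close>

text \<open>In the application \<open>M\<close> is Lebesgue measure on \<Omega>,
  \<open>k x y\<close> is \<open>J (x - y)\<close> and \<open>b x\<close> is the mass of
  \<open>J (x - _)\<close> outside \<Omega>. Since the exterior enters only through
  \<open>b\<close>, the measure is finite and bounded functions are admissible test
  functions.\<close>

locale nonlocal_kernel = finite_measure M for M :: "'a measure" +
  fixes k :: "'a \<Rightarrow> 'a \<Rightarrow> real" and b :: "'a \<Rightarrow> real" and B c :: real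
  assumes k_measurable [measurable]: "case_prod k \<in> borel_measurable (M \<Otimes>\<^sub>M M)"
    and k_nonneg: "0 \<le> k x y" and k_le: "k x y \<le> B"
    and b_measurable [measurable]: "b \<in> borel_measurable M"
    and b_nonneg: "0 \<le> b x" and b_le: "b x \<le> B"
    and c_pos: "c > 0"
begin

lemma B_nonneg: "0 \<le> B"
  using b_nonneg b_le order_trans by blast

lemma k_section_measurable: "x \<in> space M \<Longrightarrow> k x \<in> borel_measurable M"
  using measurable_Pair2[OF k_measurable, of x] by simp

definition T :: "('a \<Rightarrow> real) \<Rightarrow> 'a \<Rightarrow> real" where
  "T w x = (LINT y|M. k x y * w y)"

definition h :: "('a \<Rightarrow> real) \<Rightarrow> 'a \<Rightarrow> real" where
  "h p x = b x + T p x"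

text \<open>
  For the indicator of the perforated set, the right-hand side is the nonlocal energy of the
  competitor \<open>p \<phi>\<close>, so this is the lower bound on the first eigenvalue. In this form, unlike as
  a bound on the eigenvalue, it passes to weak limits of \<open>p\<close>.
\<close>

definition coercive :: "('a \<Rightarrow> real) \<Rightarrow> bool" where
  "coercive p \<longleftrightarrow> (\<forall>\<phi> \<in> L2 M.
     c * (LINT x|M. p x * (\<phi> x)\<^sup>2)
       \<le> (LINT x|M. p x * ((\<phi> x)\<^sup>2 * h p x)) - (LINT x|M. p x * (\<phi> x * T (\<lambda>y. p y * \<phi> y) x)))"

section \<open>Bounds and weak continuity of \<open>T\<close> and \<open>h\<close>\<close>

lemma L2_bounded:
  assumes "u \<in> borel_measurable M" "\<And>x. x \<in> space M \<Longrightarrow> \<bar>u x\<bar> \<le> C"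
  shows "u \<in> L2 M"
proof -
  have "(\<lambda>_. 1) \<in> L2 M" by (simp add: L2_def)
  then show ?thesis by (rule L2_dominated[of _ _ _ C]) (use assms in auto)
qed

lemma L2_integrable: "u \<in> L2 M \<Longrightarrow> integrable M u"
  using L2_integrable_mult[of u M "\<lambda>_. 1"] by (simp add: L2_def)

lemma integrable_k_mult:
  assumes "integrable M w" "x \<in> space M"
  shows "integrable M (\<lambda>y. k x y * w y)"
proof (rule Bochner_Integration.integrable_bound)
  show "integrable M (\<lambda>y. B * \<bar>w y\<bar>)" using assms by simp
  show "AE y in M. norm (k x y * w y) \<le> norm (B * \<bar>w y\<bar>)"
    using k_nonneg k_le B_nonneg by (auto simp: abs_mult intro!: mult_right_mono)
qed (use assms k_section_measurable in auto)

lemma T_measurable [measurable]: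
  assumes [measurable]: "w \<in> borel_measurable M"
  shows "T w \<in> borel_measurable M"
  unfolding T_def by measurable

lemma T_abs_le:
  assumes "integrable M w" "x \<in> space M"
  shows "\<bar>T w x\<bar> \<le> B * (LINT y|M. \<bar>w y\<bar>)"
proof -
  have "\<bar>T w x\<bar> \<le> (LINT y|M. \<bar>k x y * w y\<bar>)" unfolding T_def by simp
  also have "\<dots> \<le> (LINT y|M. B * \<bar>w y\<bar>)"
    using integrable_k_mult[OF integrable_abs[OF assms(1)] assms(2)] assms k_nonneg k_le
    by (intro integral_mono) (auto simp: abs_mult intro!: mult_right_mono)
  finally show ?thesis by simp
qed

lemma T_diff:
  assumes "integrable M w" "integrable M v" "x \<in> space M"
  shows "T (\<lambda>y. w y - v y) x = T w x - T v x"
  using assms integrable_k_mult by (simp add: T_def right_diff_distrib)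

lemma T_cong_AE:
  assumes "w \<in> borel_measurable M" "v \<in> borel_measurable M" "AE x in M. w x = v x" "x \<in> space M"
  shows "T w x = T v x"
  unfolding T_def by (rule integral_cong_AE) (use assms k_section_measurable in auto)

lemma T_nonneg: "(\<And>y. 0 \<le> w y) \<Longrightarrow> 0 \<le> T w x"
  unfolding T_def by (intro Bochner_Integration.integral_nonneg) (simp add: k_nonneg)

lemma weight_integrable: "weight M p \<Longrightarrow> integrable M p"
  using integrable_weight_mult[of M p "\<lambda>_. 1"] by simp

lemma weight_integral_le: "weight M p \<Longrightarrow> (LINT x|M. \<bar>p x\<bar>) \<le> measure M (space M)"
  using integral_mono[of M "\<lambda>x. \<bar>p x\<bar>" "\<lambda>_. 1"] weight_integrable[of p] weightD(4)[of M p] by simp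

definition H :: real where "H = B + B * measure M (space M)"

lemma h_measurable [measurable]: "p \<in> borel_measurable M \<Longrightarrow> h p \<in> borel_measurable M"
  unfolding h_def by measurable

lemma h_bounds:
  assumes p: "weight M p" and x: "x \<in> space M"
  shows "0 \<le> h p x" "h p x \<le> H" "\<bar>h p x\<bar> \<le> H"
proof -
  have "\<bar>T p x\<bar> \<le> B * measure M (space M)"
    using T_abs_le[OF weight_integrable[OF p] x] mult_left_mono[OF weight_integral_le[OF p] B_nonneg] by simp
  moreover have "0 \<le> T p x" using weightD[OF p] by (intro T_nonneg)
  ultimately show "0 \<le> h p x" "h p x \<le> H" "\<bar>h p x\<bar> \<le> H"
    using b_nonneg[of x] b_le[of x] unfolding h_def H_def by linarith+
qed

text \<open>For fixed \<open>x\<close> the function \<open>k x y * \<phi> y\<close> of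
  \<open>y\<close> is integrable, hence a test function: the operator turns weak convergence into
  pointwise convergence.\<close>

lemma wlim_T:
  assumes "wlim M p q" "integrable M \<phi>" "x \<in> space M"
  shows "(\<lambda>n. T (\<lambda>y. p n y * \<phi> y) x) \<longlonglongrightarrow> T (\<lambda>y. q y * \<phi> y) x"
proof -
  have "(\<lambda>n. LINT y|M. p n y * (k x y * \<phi> y)) \<longlonglongrightarrow> (LINT y|M. q y * (k x y * \<phi> y))"
    using assms integrable_k_mult[OF assms(2,3)] by (simp add: wlim_def)
  then show ?thesis by (simp add: T_def mult.left_commute)
qed

lemma wlim_h:
  assumes "wlim M p q" "x \<in> space M"
  shows "(\<lambda>n. h (p n) x) \<longlonglongrightarrow> h q x"
  using wlim_T[OF assms(1) _ assms(2), of "\<lambda>_. 1"] unfolding h_def by (auto intro: tendsto_add)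

section \<open>Coercivity: weak limits, energy bound and uniqueness\<close>

lemma integrable_mult_h:
  assumes "weight M p" "integrable M g"
  shows "integrable M (\<lambda>x. g x * h p x)"
proof (rule Bochner_Integration.integrable_bound)
  show "integrable M (\<lambda>x. H * \<bar>g x\<bar>)" using assms by simp
  show "AE x in M. norm (g x * h p x) \<le> norm (H * \<bar>g x\<bar>)"
  proof (rule AE_I2)
    fix x assume "x \<in> space M"
    then have "0 \<le> H" "\<bar>h p x\<bar> \<le> H" using h_bounds[OF assms(1), of x] by auto
    then show "norm (g x * h p x) \<le> norm (H * \<bar>g x\<bar>)"
      using mult_right_mono[of "\<bar>h p x\<bar>" H "\<bar>g x\<bar>"] by (simp add: abs_mult mult.commute)
  qed
qed (use assms in \<open>auto dest: weightD(1)\<close>)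

lemma integrable_mult_T:
  assumes "integrable M w" "integrable M g"
  shows "integrable M (\<lambda>x. g x * T w x)"
proof (rule Bochner_Integration.integrable_bound)
  show "integrable M (\<lambda>x. B * (LINT y|M. \<bar>w y\<bar>) * \<bar>g x\<bar>)" using assms by simp
  show "AE x in M. norm (g x * T w x) \<le> norm (B * (LINT y|M. \<bar>w y\<bar>) * \<bar>g x\<bar>)"
  proof (rule AE_I2)
    fix x assume "x \<in> space M"
    from T_abs_le[OF assms(1) this] show "norm (g x * T w x) \<le> norm (B * (LINT y|M. \<bar>w y\<bar>) * \<bar>g x\<bar>)"
      using mult_right_mono[of "\<bar>T w x\<bar>" "B * (LINT y|M. \<bar>w y\<bar>)" "\<bar>g x\<bar>"] B_nonneg
      by (simp add: abs_mult mult.commute)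
  qed
qed (use assms in auto)

text \<open>The energy is quadratic in \<open>p\<close>, which weak convergence alone does not
  control. But \<open>h (p n)\<close> and \<open>T (\<lambda>y. p n y * \<phi> y)\<close> converge
  pointwise with uniform bounds, so \<open>wlim_mult_tendsto\<close> applies with the outer
  \<open>p n\<close> as weight.\<close>

lemma coercive_limit:
  assumes p: "\<And>n. weight M (p n)" "\<And>n. coercive (p n)" and q: "weight M q" "wlim M p q"
  shows "coercive q"
  unfolding coercive_def
proof
  fix \<phi> assume \<phi>: "\<phi> \<in> L2 M"
  note [measurable] = L2_measurable[OF \<phi>] weightD(1)[OF p(1)]
  have 1: "(\<lambda>n. LINT x|M. p n x * (\<phi> x)\<^sup>2) \<longlonglongrightarrow> (LINT x|M. q x * (\<phi> x)\<^sup>2)"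
    using q(2) L2_integrable_square[OF \<phi>] by (simp add: wlim_def)
  have 2: "(\<lambda>n. LINT x|M. p n x * ((\<phi> x)\<^sup>2 * h (p n) x)) \<longlonglongrightarrow> (LINT x|M. q x * ((\<phi> x)\<^sup>2 * h q x))"
  proof (rule wlim_mult_tendsto[OF p(1) q(2), where D = "\<lambda>x. (\<phi> x)\<^sup>2 * H"])
    show "\<bar>(\<phi> x)\<^sup>2 * h (p n) x\<bar> \<le> (\<phi> x)\<^sup>2 * H" if "x \<in> space M" for n x
      using h_bounds[OF p(1) that] by (simp add: abs_mult mult_left_mono)
  qed (use wlim_h[OF q(2)] L2_integrable_square[OF \<phi>] in \<open>auto intro!: tendsto_intros\<close>)
  have \<phi>I: "integrable M \<phi>" by (rule L2_integrable[OF \<phi>])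
  have 3: "(\<lambda>n. LINT x|M. p n x * (\<phi> x * T (\<lambda>y. p n y * \<phi> y) x))
      \<longlonglongrightarrow> (LINT x|M. q x * (\<phi> x * T (\<lambda>y. q y * \<phi> y) x))"
  proof (rule wlim_mult_tendsto[OF p(1) q(2), where D = "\<lambda>x. \<bar>\<phi> x\<bar> * (B * (LINT y|M. \<bar>\<phi> y\<bar>))"])
    fix n x assume x: "x \<in> space M"
    have "(LINT y|M. \<bar>p n y * \<phi> y\<bar>) \<le> (LINT y|M. \<bar>\<phi> y\<bar>)"
      using integrable_weight_mult[OF p(1) \<phi>I] \<phi>I weight_mult_le[OF p(1)] by (intro integral_mono) auto
    then have "\<bar>T (\<lambda>y. p n y * \<phi> y) x\<bar> \<le> B * (LINT y|M. \<bar>\<phi> y\<bar>)"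
      using T_abs_le[OF integrable_weight_mult[OF p(1) \<phi>I] x, of n] B_nonneg
      by (meson mult_left_mono order_trans)
    then show "\<bar>\<phi> x * T (\<lambda>y. p n y * \<phi> y) x\<bar> \<le> \<bar>\<phi> x\<bar> * (B * (LINT y|M. \<bar>\<phi> y\<bar>))"
      by (simp add: abs_mult mult_left_mono)
  qed (use wlim_T[OF q(2) \<phi>I] \<phi>I in \<open>auto intro!: tendsto_intros\<close>)
  show "c * (LINT x|M. q x * (\<phi> x)\<^sup>2)
       \<le> (LINT x|M. q x * ((\<phi> x)\<^sup>2 * h q x)) - (LINT x|M. q x * (\<phi> x * T (\<lambda>y. q y * \<phi> y) x))"
    by (rule LIMSEQ_le[OF tendsto_mult_left[OF 1] tendsto_diff[OF 2 3]])
      (use p(2) \<phi> in \<open>auto simp: coercive_def\<close>)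
qed

lemma coercive_h_ge:
  assumes p: "weight M p" "coercive p"
  shows "AE x in M. p x \<noteq> 0 \<longrightarrow> c \<le> h p x"
proof -
  note [measurable] = weightD(1)[OF p(1)]
  \<comment> \<open>The nonlocal term is nonnegative on this test function, so it can be dropped.\<close>
  define \<phi> where "\<phi> x = (if h p x < c then 1 else 0 :: real)" for x
  have \<phi>m[measurable]: "\<phi> \<in> borel_measurable M" unfolding \<phi>_def by measurable
  have \<phi>: "\<phi> \<in> L2 M" by (rule L2_bounded[where C = 1]) (auto simp: \<phi>_def)
  have \<phi>0: "0 \<le> \<phi> x" for x by (simp add: \<phi>_def)
  have i1: "integrable M (\<lambda>x. p x * (\<phi> x)\<^sup>2)"
    by (rule integrable_weight_mult[OF p(1) L2_integrable_square[OF \<phi>]])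
  have i2: "integrable M (\<lambda>x. p x * ((\<phi> x)\<^sup>2 * h p x))"
    by (intro integrable_weight_mult[OF p(1)] integrable_mult_h[OF p(1)] L2_integrable_square[OF \<phi>])
  have "0 \<le> (LINT x|M. p x * (\<phi> x * T (\<lambda>y. p y * \<phi> y) x))"
    by (intro Bochner_Integration.integral_nonneg mult_nonneg_nonneg weightD[OF p(1)] \<phi>0 T_nonneg)
  moreover have "c * (LINT x|M. p x * (\<phi> x)\<^sup>2)
       \<le> (LINT x|M. p x * ((\<phi> x)\<^sup>2 * h p x)) - (LINT x|M. p x * (\<phi> x * T (\<lambda>y. p y * \<phi> y) x))"
    using p(2) \<phi> by (simp add: coercive_def)
  ultimately have "(LINT x|M. c * (p x * (\<phi> x)\<^sup>2) - p x * ((\<phi> x)\<^sup>2 * h p x)) \<le> 0"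
    using i1 i2 by simp
  \<comment> \<open>The integrand is \<open>p x * (c - h p x)\<close> where \<open>h p x < c\<close>
    and zero elsewhere. Being nonnegative with integral at most zero it vanishes a.e., so
    \<open>p\<close> is zero a.e. on that set.\<close>
  moreover have nn: "0 \<le> c * (p x * (\<phi> x)\<^sup>2) - p x * ((\<phi> x)\<^sup>2 * h p x)" for x
    using weightD(2)[OF p(1), of x] mult_left_mono[of "h p x" c "p x"] by (auto simp: \<phi>_def mult.commute)
  moreover have "0 \<le> (LINT x|M. c * (p x * (\<phi> x)\<^sup>2) - p x * ((\<phi> x)\<^sup>2 * h p x))"
    by (intro Bochner_Integration.integral_nonneg nn)
  ultimately have "(LINT x|M. c * (p x * (\<phi> x)\<^sup>2) - p x * ((\<phi> x)\<^sup>2 * h p x)) = 0" by linarith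
  then have "AE x in M. c * (p x * (\<phi> x)\<^sup>2) - p x * ((\<phi> x)\<^sup>2 * h p x) = 0"
    using i1 i2 nn by (subst (asm) integral_nonneg_eq_0_iff_AE) auto
  then show ?thesis
    by eventually_elim (auto simp: \<phi>_def split: if_splits)
qed

text \<open>Multiplying the equation by \<open>w\<close> and integrating shows that the energy of
  \<open>w\<close> is minus the integral of \<open>f x * w x\<close>. By \<open>pw\<close>,
  \<open>w\<close> vanishes a.e. where \<open>p\<close> is not one, so \<open>w\<close> can be the
  test function and the factors \<open>p\<close> drop out.\<close>

lemma energy_bound:
  assumes p: "weight M p" "coercive p" and f: "f \<in> L2 M" and w: "w \<in> L2 M"
    and pw: "AE x in M. p x * w x = w x"
    and eq: "AE x in M. p x * f x = p x * T w x - h p x * w x"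
  shows "(LINT x|M. (w x)\<^sup>2) \<le> (LINT x|M. (f x)\<^sup>2) / c\<^sup>2"
proof -
  note [measurable] = weightD(1)[OF p(1)] L2_measurable[OF f] L2_measurable[OF w]
  have wI: "integrable M w" by (rule L2_integrable[OF w])
  have w2: "integrable M (\<lambda>x. (w x)\<^sup>2)" by (rule L2_integrable_square[OF w])
  have f2: "integrable M (\<lambda>x. (f x)\<^sup>2)" by (rule L2_integrable_square[OF f])
  have fw: "integrable M (\<lambda>x. f x * w x)" by (rule L2_integrable_mult[OF f w])
  have "c * (LINT x|M. p x * (w x)\<^sup>2)
       \<le> (LINT x|M. p x * ((w x)\<^sup>2 * h p x)) - (LINT x|M. p x * (w x * T (\<lambda>y. p y * w y) x))"
    using p(2) w by (simp add: coercive_def)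
  also have "(LINT x|M. p x * (w x)\<^sup>2) = (LINT x|M. (w x)\<^sup>2)"
    using pw by (intro integral_cong_AE) (auto simp: power2_eq_square simp flip: mult.assoc)
  also have "(LINT x|M. p x * ((w x)\<^sup>2 * h p x)) = (LINT x|M. (w x)\<^sup>2 * h p x)"
    using pw by (intro integral_cong_AE) (auto simp: power2_eq_square simp flip: mult.assoc)
  also have "(LINT x|M. p x * (w x * T (\<lambda>y. p y * w y) x)) = (LINT x|M. w x * T w x)"
  proof (rule integral_cong_AE)
    have TT: "T (\<lambda>y. p y * w y) x = T w x" if "x \<in> space M" for x
      by (rule T_cong_AE[OF _ _ pw that]) auto
    show "AE x in M. p x * (w x * T (\<lambda>y. p y * w y) x) = w x * T w x"
      using pw AE_space by eventually_elim (simp add: TT flip: mult.assoc)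
  qed auto
  also have "(LINT x|M. (w x)\<^sup>2 * h p x) - (LINT x|M. w x * T w x)
      = (LINT x|M. (w x)\<^sup>2 * h p x - w x * T w x)"
    using integrable_mult_h[OF p(1) w2] integrable_mult_T[OF wI wI] by simp
  also have "\<dots> = (LINT x|M. - (f x * w x))"
  proof (rule integral_cong_AE)
    show "AE x in M. (w x)\<^sup>2 * h p x - w x * T w x = - (f x * w x)"
      using pw eq
    proof eventually_elim
      case (elim x)
      have "f x * w x = (p x * f x) * w x" using elim(1) by (metis mult.assoc mult.commute)
      also have "\<dots> = (p x * w x) * T w x - h p x * w x * w x"
        unfolding elim(2) by (simp add: algebra_simps)
      finally show ?case using elim(1) by (simp add: power2_eq_square algebra_simps)
    qed
  qed auto
  \<comment> \<open>Young's inequality, weighted so that half of the coercive term absorbs the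
    contribution of \<open>w\<close>.\<close>
  also have "\<dots> \<le> (LINT x|M. c / 2 * (w x)\<^sup>2 + (f x)\<^sup>2 / (2 * c))"
  proof (rule integral_mono)
    fix x
    have "0 \<le> (c * w x + f x)\<^sup>2 / (2 * c)" using c_pos by simp
    also have "\<dots> = c / 2 * (w x)\<^sup>2 + (f x)\<^sup>2 / (2 * c) + f x * w x"
      using c_pos by (simp add: field_simps power2_eq_square)
    finally show "- (f x * w x) \<le> c / 2 * (w x)\<^sup>2 + (f x)\<^sup>2 / (2 * c)" by simp
  qed (use fw w2 f2 in auto)
  also have "\<dots> = c / 2 * (LINT x|M. (w x)\<^sup>2) + (LINT x|M. (f x)\<^sup>2) / (2 * c)"
    using w2 f2 by simp
  finally have "c / 2 * (LINT x|M. (w x)\<^sup>2) \<le> (LINT x|M. (f x)\<^sup>2) / (2 * c)" by simp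
  then show ?thesis using c_pos by (simp add: field_simps power2_eq_square)
qed

text \<open>
  The equation \<open>p f = p T w - h p w\<close> solved for \<open>w\<close>; the truncation of \<open>h p\<close> at \<open>c\<close> is harmless
  by \<open>coercive_h_ge\<close> and makes the quotient depend continuously on \<open>h p\<close>.
\<close>

definition fixed :: "('a \<Rightarrow> real) \<Rightarrow> ('a \<Rightarrow> real) \<Rightarrow> ('a \<Rightarrow> real) \<Rightarrow> bool" where
  "fixed f p w \<longleftrightarrow> w \<in> L2 M \<and> (AE x in M. w x = p x * ((T w x - f x) / max (h p x) c))"

text \<open>Where \<open>p\<close> vanishes the equation only says \<open>h p x * w x = 0\<close>,
  and \<open>h p x\<close> may be zero there; hence the separate hypothesis \<open>pw\<close>.
  Elsewhere \<open>coercive_h_ge\<close> permits division by \<open>h p x\<close>.\<close>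

lemma fixedI:
  assumes p: "weight M p" "coercive p" and w: "w \<in> L2 M"
    and pw: "AE x in M. p x = 0 \<longrightarrow> w x = 0"
    and eq: "AE x in M. p x * f x = p x * T w x - h p x * w x"
  shows "fixed f p w"
proof -
  have "AE x in M. w x = p x * ((T w x - f x) / max (h p x) c)"
    using pw eq coercive_h_ge[OF p]
  proof eventually_elim
    case (elim x)
    show ?case
    proof (cases "p x = 0")
      case False
      with elim c_pos show ?thesis by (simp add: field_simps max_def)
    qed (use elim in simp)
  qed
  then show ?thesis using w by (simp add: fixed_def)
qed

lemma fixedD:
  assumes p: "weight M p" "coercive p" and w: "fixed f p w"
  shows "AE x in M. p x * f x = p x * T w x - h p x * w x"
proof -
  have "AE x in M. w x = p x * ((T w x - f x) / max (h p x) c)" using w by (simp add: fixed_def)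
  then show ?thesis using coercive_h_ge[OF p]
  proof eventually_elim
    case (elim x)
    show ?case
    proof (cases "p x = 0")
      case False
      with elim c_pos have h: "max (h p x) c = h p x" "h p x \<noteq> 0" by auto
      have "h p x * w x = p x * (T w x - f x)"
        using elim(1) h by (simp add: field_simps)
      then show ?thesis by (simp add: algebra_simps)
    qed (use elim in simp)
  qed
qed

text \<open>A weak limit \<open>p\<close> may lie strictly between 0 and 1, where
  \<open>p x * w x = w x\<close> fails and \<open>energy_bound\<close> does not apply. With
  \<open>\<psi>\<close> as test function the two energy terms coincide, because
  \<open>h p x * \<psi> x = T z x\<close> a.e. where \<open>p x\<close> is nonzero. Coercivity then
  forces \<open>p x * (\<psi> x)\<^sup>2 = 0\<close> a.e., so \<open>z\<close> vanishes.\<close>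

lemma fixed_unique:
  assumes p: "weight M p" "coercive p" and f: "f \<in> L2 M" and w: "fixed f p w" and v: "fixed f p v"
  shows "AE x in M. w x = v x"
proof -
  have L: "w \<in> L2 M" "v \<in> L2 M" using w v by (auto simp: fixed_def)
  define z where "z x = w x - v x" for x
  have z: "z \<in> L2 M" unfolding z_def by (rule L2_diff[OF L])
  note zI = L2_integrable[OF z]
  note [measurable] = weightD(1)[OF p(1)] L2_measurable[OF z]
  have Tz: "T z x = T w x - T v x" if "x \<in> space M" for x
    using T_diff[OF L2_integrable[OF L(1)] L2_integrable[OF L(2)] that] by (simp add: z_def[abs_def])
  \<comment> \<open>Coercivity can be tested with \<open>\<psi>\<close> since the difference is \<open>z = p \<psi>\<close> with \<open>\<psi>\<close> bounded.\<close>
  define \<psi> where "\<psi> x = T z x / max (h p x) c" for x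
  have [measurable]: "\<psi> \<in> borel_measurable M" unfolding \<psi>_def by measurable
  have \<psi>: "\<psi> \<in> L2 M"
  proof (rule L2_bounded[where C = "B * (LINT y|M. \<bar>z y\<bar>) / c"])
    fix x assume "x \<in> space M"
    from T_abs_le[OF zI this] show "\<bar>\<psi> x\<bar> \<le> B * (LINT y|M. \<bar>z y\<bar>) / c"
      using c_pos unfolding \<psi>_def abs_divide by (intro frac_le) auto
  qed auto
  have zp: "AE x in M. p x * \<psi> x = z x"
  proof -
    have "AE x in M. w x = p x * ((T w x - f x) / max (h p x) c)"
      "AE x in M. v x = p x * ((T v x - f x) / max (h p x) c)"
      using w v by (auto simp: fixed_def)
    with AE_space show ?thesis
    proof eventually_elim
      case (elim x)
      have "w x - v x = p x * (((T w x - f x) - (T v x - f x)) / max (h p x) c)"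
        by (subst elim(2), subst elim(3)) (simp only: diff_divide_distrib right_diff_distrib)
      then show ?case using Tz[OF elim(1)] by (simp add: z_def \<psi>_def)
    qed
  qed
  have "c * (LINT x|M. p x * (\<psi> x)\<^sup>2)
       \<le> (LINT x|M. p x * ((\<psi> x)\<^sup>2 * h p x)) - (LINT x|M. p x * (\<psi> x * T (\<lambda>y. p y * \<psi> y) x))"
    using p(2) \<psi> by (simp add: coercive_def)
  also have "(LINT x|M. p x * (\<psi> x * T (\<lambda>y. p y * \<psi> y) x)) = (LINT x|M. p x * ((\<psi> x)\<^sup>2 * h p x))"
  proof (rule integral_cong_AE)
    have TT: "T (\<lambda>y. p y * \<psi> y) x = T z x" if "x \<in> space M" for x
      by (rule T_cong_AE[OF _ _ zp that]) auto
    show "AE x in M. p x * (\<psi> x * T (\<lambda>y. p y * \<psi> y) x) = p x * ((\<psi> x)\<^sup>2 * h p x)"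
      using AE_space coercive_h_ge[OF p]
    proof eventually_elim
      case (elim x)
      show ?case
      proof (cases "p x = 0")
        case False
        with elim c_pos have "max (h p x) c = h p x" "h p x \<noteq> 0" by auto
        then have "\<psi> x * h p x = T z x" by (simp add: \<psi>_def)
        then show ?thesis using elim by (simp add: TT power2_eq_square)
      qed simp
    qed
  qed auto
  finally have "(LINT x|M. p x * (\<psi> x)\<^sup>2) \<le> 0" using c_pos by (simp add: mult_le_0_iff)
  moreover have nn: "0 \<le> p x * (\<psi> x)\<^sup>2" for x using weightD(2)[OF p(1)] by simp
  moreover have "0 \<le> (LINT x|M. p x * (\<psi> x)\<^sup>2)" by (intro Bochner_Integration.integral_nonneg nn)
  ultimately have "(LINT x|M. p x * (\<psi> x)\<^sup>2) = 0" by linarith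
  then have "AE x in M. p x * (\<psi> x)\<^sup>2 = 0"
    using nn integrable_weight_mult[OF p(1) L2_integrable_square[OF \<psi>]]
    by (subst (asm) integral_nonneg_eq_0_iff_AE) auto
  with zp show ?thesis
  proof eventually_elim
    case (elim x)
    then have "z x = 0" by (metis mult_eq_0_iff power_eq_0_iff)
    then show ?case by (simp add: z_def)
  qed
qed

end

section \<open>Compactness and passage to the limit\<close>

locale compact_nonlocal_kernel = nonlocal_kernel M k b B c
  for M :: "'a measure" and k b B c +
  assumes T_compact: "\<And>w C. \<lbrakk>\<And>n :: nat. integrable M (w n); \<And>n. (LINT x|M. \<bar>w n x\<bar>) \<le> C\<rbrakk> \<Longrightarrow>
    \<exists>g (r :: nat \<Rightarrow> nat). strict_mono r \<and> (\<forall>x\<in>space M. (\<lambda>n. T (w (r n)) x) \<longlonglongrightarrow> g x)"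
begin

text \<open>A two-valued weight gives \<open>p x * w x = w x\<close> a.e., as
  \<open>energy_bound\<close> requires. On a finite measure space
  \<open>\<bar>w x\<bar> \<le> 1 + (w x)\<^sup>2\<close> turns its L2 bound into the L1 bound that
  \<open>T_compact\<close> asks for.\<close>

lemma L1_bound:
  assumes p: "weight M p" "coercive p" and f: "f \<in> L2 M" and w: "fixed f p w"
    and pp: "\<And>x. p x = 0 \<or> p x = 1"
  shows "(LINT x|M. \<bar>w x\<bar>) \<le> measure M (space M) + (LINT x|M. (f x)\<^sup>2) / c\<^sup>2"
proof -
  have wL: "w \<in> L2 M" using w by (simp add: fixed_def)
  have "AE x in M. w x = p x * ((T w x - f x) / max (h p x) c)" using w by (simp add: fixed_def)
  then have pw: "AE x in M. p x * w x = w x"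
  proof eventually_elim
    case (elim x) then show ?case using pp[of x] by auto
  qed
  have "(LINT x|M. \<bar>w x\<bar>) \<le> (LINT x|M. 1 + (w x)\<^sup>2)"
  proof (rule integral_mono)
    fix x
    have "0 \<le> (\<bar>w x\<bar> - 1)\<^sup>2" "0 \<le> \<bar>w x\<bar>" by auto
    then show "\<bar>w x\<bar> \<le> 1 + (w x)\<^sup>2" unfolding power2_diff by simp
  qed (use L2_integrable[OF wL] L2_integrable_square[OF wL] in auto)
  also have "\<dots> = measure M (space M) + (LINT x|M. (w x)\<^sup>2)"
    using L2_integrable_square[OF wL] by simp
  also have "(LINT x|M. (w x)\<^sup>2) \<le> (LINT x|M. (f x)\<^sup>2) / c\<^sup>2"
    by (rule energy_bound[OF p f wL pw fixedD[OF p w]])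
  finally show ?thesis by simp
qed

text \<open>Almost everywhere \<open>w (r n)\<close> is \<open>p (r n)\<close> times
  \<open>F n\<close>, and \<open>F n\<close> converges pointwise because \<open>T (w (r n))\<close>
  and \<open>h (p (r n))\<close> do. The product thus converges weakly to \<open>q\<close> times
  \<open>G\<close>, an explicit limit; only afterwards is \<open>g\<close> recognised as
  \<open>T u\<close>.\<close>

lemma fixed_subsequence:
  assumes p: "\<And>n. weight M (p n)" "\<And>n. coercive (p n)" "\<And>n x. p n x = 0 \<or> p n x = 1"
    and q: "weight M q" "wlim M p q" and f: "f \<in> L2 M" and w: "\<And>n. fixed f (p n) (w n)"
  shows "\<exists>u (r :: nat \<Rightarrow> nat). strict_mono r \<and> fixed f q u \<and>
    (\<forall>\<phi>\<in>L2 M. (\<lambda>n. LINT x|M. w (r n) x * \<phi> x) \<longlonglongrightarrow> (LINT x|M. u x * \<phi> x))"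
proof -
  define C where "C = measure M (space M) + (LINT x|M. (f x)\<^sup>2) / c\<^sup>2"
  have wL: "w n \<in> L2 M" for n using w by (simp add: fixed_def)
  have wI: "integrable M (w n)" for n by (rule L2_integrable[OF wL])
  have wC: "(LINT x|M. \<bar>w n x\<bar>) \<le> C" for n
    unfolding C_def by (rule L1_bound[OF p(1,2) f w p(3)])
  obtain g r where r: "strict_mono (r :: nat \<Rightarrow> nat)" and g: "\<And>x. x \<in> space M \<Longrightarrow> (\<lambda>n. T (w (r n)) x) \<longlonglongrightarrow> g x"
    using T_compact[of w, OF wI wC] by blast
  note [measurable] = weightD(1)[OF p(1)] weightD(1)[OF q(1)] L2_measurable[OF f] L2_measurable[OF wL]
  have gm[measurable]: "g \<in> borel_measurable M"
    by (rule borel_measurable_LIMSEQ_real[of M "\<lambda>n. T (w (r n))"]) (use g in auto)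
  have TC: "\<bar>T (w n) x\<bar> \<le> B * C" if "x \<in> space M" for n x
    using T_abs_le[OF wI that, of n] mult_left_mono[OF wC[of n] B_nonneg] by linarith
  have gC: "\<bar>g x\<bar> \<le> B * C" if "x \<in> space M" for x
    by (rule LIMSEQ_le_const2[OF tendsto_rabs[OF g[OF that]]]) (use TC[OF that] in auto)
  have pr: "weight M (p (r n))" for n by (rule p(1))
  have qr: "wlim M (\<lambda>n. p (r n)) q"
    unfolding wlim_def
  proof (intro allI impI)
    fix \<psi> :: "'a \<Rightarrow> real" assume "integrable M \<psi>"
    then have "(\<lambda>n. LINT x|M. p n x * \<psi> x) \<longlonglongrightarrow> (LINT x|M. q x * \<psi> x)"
      using q(2) by (simp add: wlim_def)
    from LIMSEQ_subseq_LIMSEQ[OF this r]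
    show "(\<lambda>n. LINT x|M. p (r n) x * \<psi> x) \<longlonglongrightarrow> (LINT x|M. q x * \<psi> x)"
      by (simp add: comp_def)
  qed
  define F where "F n x = (T (w (r n)) x - f x) / max (h (p (r n)) x) c" for n x
  define G where "G x = (g x - f x) / max (h q x) c" for x
  have Fm[measurable]: "F n \<in> borel_measurable M" for n unfolding F_def by measurable
  have Gm[measurable]: "G \<in> borel_measurable M" unfolding G_def by measurable
  have FG: "(\<lambda>n. F n x) \<longlonglongrightarrow> G x" if "x \<in> space M" for x
    unfolding F_def G_def using c_pos
    by (intro tendsto_intros g that wlim_h[OF qr]) auto
  have Fb: "\<bar>F n x\<bar> \<le> (B * C + \<bar>f x\<bar>) / c" if "x \<in> space M" for n x
    unfolding F_def abs_divide using c_pos TC[OF that, of "r n"] by (intro frac_le) auto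
  have Gb: "\<bar>G x\<bar> \<le> (B * C + \<bar>f x\<bar>) / c" if "x \<in> space M" for x
    unfolding G_def abs_divide using c_pos gC[OF that] by (intro frac_le) auto
  have BCc: "0 \<le> B * C" if "x \<in> space M" for x using gC[OF that] by linarith
  \<comment> \<open>A common L2 majorant of all \<open>F n\<close> and of \<open>G\<close>, the
    denominators being at least \<open>c\<close>; its product with any L2 test function is an
    integrable majorant.\<close>
  define D where "D x = (\<bar>B * C\<bar> + \<bar>f x\<bar>) / c" for x
  have "(\<lambda>x. \<bar>B * C\<bar> + \<bar>f x\<bar>) \<in> L2 M"
    by (intro L2_add L2_bounded[where C = "\<bar>B * C\<bar>"] L2_dominated[OF f, of _ 1]) auto
  then have DL: "D \<in> L2 M"
    by (rule L2_dominated[where C = "1 / c"]) (use c_pos in \<open>auto simp: D_def[abs_def]\<close>)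
  have FD: "\<bar>F n x\<bar> \<le> D x" "\<bar>G x\<bar> \<le> D x" if "x \<in> space M" for n x
    using Fb[OF that, of n] Gb[OF that] BCc[OF that] by (auto simp: D_def)
  have GL: "G \<in> L2 M"
    by (rule L2_dominated[OF DL Gm, of 1]) (auto intro!: AE_I2 order_trans[OF FD(2)])
  define u where "u x = q x * G x" for x
  have uL: "u \<in> L2 M" unfolding u_def by (rule L2_weight_mult[OF q(1) GL])
  have conv: "(\<lambda>n. LINT x|M. w (r n) x * \<phi> x) \<longlonglongrightarrow> (LINT x|M. u x * \<phi> x)" if \<phi>: "\<phi> \<in> L2 M" for \<phi>
  proof -
    note [measurable] = L2_measurable[OF \<phi>]
    have "(\<lambda>n. LINT x|M. p (r n) x * (F n x * \<phi> x)) \<longlonglongrightarrow> (LINT x|M. q x * (G x * \<phi> x))"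
    proof (rule wlim_mult_tendsto[OF pr qr, where D = "\<lambda>x. \<bar>D x * \<phi> x\<bar>"])
      show "\<bar>F n x * \<phi> x\<bar> \<le> \<bar>D x * \<phi> x\<bar>" if "x \<in> space M" for n x
        unfolding abs_mult using FD(1)[OF that, of n] by (intro mult_right_mono) auto
    qed (use FG L2_integrable_mult[OF DL \<phi>] in \<open>auto intro!: tendsto_intros\<close>)
    moreover have "(LINT x|M. w (r n) x * \<phi> x) = (LINT x|M. p (r n) x * (F n x * \<phi> x))" for n
    proof (rule integral_cong_AE)
      have "AE x in M. w (r n) x = p (r n) x * F n x" using w[of "r n"] by (simp add: fixed_def F_def)
      then show "AE x in M. w (r n) x * \<phi> x = p (r n) x * (F n x * \<phi> x)"
        by eventually_elim simp
    qed auto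
    ultimately show ?thesis by (simp add: u_def mult.assoc)
  qed
  \<comment> \<open>The section \<open>k x\<close> is bounded, hence an L2 test function, and
    pairing with it is \<open>T\<close>. So \<open>T (w (r n)) x\<close> tends to
    \<open>T u x\<close> as well as to \<open>g x\<close>.\<close>
  have "T u x = g x" if x: "x \<in> space M" for x
  proof (rule LIMSEQ_unique)
    have "k x \<in> L2 M"
      using k_section_measurable[OF x] k_nonneg k_le by (intro L2_bounded[where C = B]) auto
    from conv[OF this] show "(\<lambda>n. T (w (r n)) x) \<longlonglongrightarrow> T u x"
      by (simp add: T_def mult.commute)
  qed (rule g[OF x])
  then have "AE x in M. u x = q x * ((T u x - f x) / max (h q x) c)"
    by (auto intro!: AE_I2 simp: u_def[of _] G_def)
  then have "fixed f q u" using uL by (simp add: fixed_def)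
  then show ?thesis using r conv by blast
qed

text \<open>Subsequence principle: every sequence of parameters tending to zero has a subsequence
  along which the solutions converge weakly to a solution for \<open>q\<close>, and by
  \<open>fixed_unique\<close> it is always the same one.\<close>

lemma fixed_weak_limit:
  fixes p w :: "real \<Rightarrow> 'a \<Rightarrow> real"
  assumes p: "\<And>\<epsilon>. \<epsilon> > 0 \<Longrightarrow> weight M (p \<epsilon>)" "\<And>\<epsilon>. \<epsilon> > 0 \<Longrightarrow> coercive (p \<epsilon>)"
      "\<And>\<epsilon> x. \<epsilon> > 0 \<Longrightarrow> p \<epsilon> x = 0 \<or> p \<epsilon> x = 1"
    and q: "weight M q"
    and pq: "\<And>\<psi>. integrable M \<psi> \<Longrightarrow> ((\<lambda>\<epsilon>. LINT x|M. p \<epsilon> x * \<psi> x) \<longlongrightarrow> (LINT x|M. q x * \<psi> x)) (at_right 0)"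
    and f: "f \<in> L2 M" and w: "\<And>\<epsilon>. \<epsilon> > 0 \<Longrightarrow> fixed f (p \<epsilon>) (w \<epsilon>)"
  shows "\<exists>u. fixed f q u \<and> coercive q \<and>
    (\<forall>\<phi>\<in>L2 M. ((\<lambda>\<epsilon>. LINT x|M. w \<epsilon> x * \<phi> x) \<longlongrightarrow> (LINT x|M. u x * \<phi> x)) (at_right 0))"
proof -
  have seq: "wlim M (\<lambda>n. p (s n)) q" if "\<And>n. 0 < s n" "s \<longlonglongrightarrow> 0" for s
  proof -
    have "s n \<in> {0<..} \<and> s n \<noteq> 0" for n using that(1)[of n] by auto
    then have "filterlim s (at_right 0) sequentially" using that(2) by (simp add: filterlim_at)
    then show ?thesis unfolding wlim_def by (auto intro: filterlim_compose[OF pq])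
  qed
  have coer: "coercive q" if "\<And>n. 0 < s n" "s \<longlonglongrightarrow> 0" for s :: "nat \<Rightarrow> real"
    by (rule coercive_limit[of "\<lambda>n. p (s n)" q]) (use p q seq[OF that] that(1) in auto)
  have sub: "\<exists>u (r :: nat \<Rightarrow> nat). strict_mono r \<and> fixed f q u \<and>
      (\<forall>\<phi>\<in>L2 M. (\<lambda>n. LINT x|M. w (s (r n)) x * \<phi> x) \<longlonglongrightarrow> (LINT x|M. u x * \<phi> x))"
    if "\<And>n. 0 < s n" "s \<longlonglongrightarrow> 0" for s
    by (rule fixed_subsequence[of "\<lambda>n. p (s n)" q f "\<lambda>n. w (s n)"]) (use p q f w seq[OF that] that(1) in auto)
  \<comment> \<open>One particular sequence yields coercivity of \<open>q\<close> and the candidate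
    \<open>u\<close>; below it also serves as an upper bound that forces other sequences to
    zero.\<close>
  define s0 where "s0 n = inverse (real (Suc n))" for n
  have s0: "\<And>n. 0 < s0 n" "s0 \<longlonglongrightarrow> 0"
    using LIMSEQ_inverse_real_of_nat by (auto simp: s0_def[abs_def])
  note cq = coer[OF s0]
  obtain u where u: "fixed f q u" using sub[OF s0] by blast
  have "((\<lambda>\<epsilon>. LINT x|M. w \<epsilon> x * \<phi> x) \<longlongrightarrow> (LINT x|M. u x * \<phi> x)) (at_right 0)" if \<phi>: "\<phi> \<in> L2 M" for \<phi>
  \<comment> \<open>If convergence fails, some sequence \<open>s\<close> tends to zero while its
    pairings stay at distance at least \<open>e\<close> from the limit; a convergent subsequence
    contradicts this.\<close>
  proof (rule tendstoI, rule ccontr)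
    fix e :: real assume "e > 0"
    let ?P = "\<lambda>\<epsilon>. dist (LINT x|M. w \<epsilon> x * \<phi> x) (LINT x|M. u x * \<phi> x) < e"
    assume "\<not> eventually ?P (at_right 0)"
    then have "\<exists>s>0. s < s0 n \<and> \<not> ?P s" for n
      using s0(1)[of n] unfolding eventually_at_right_field by blast
    then obtain s where s: "\<And>n. 0 < s n" "\<And>n. s n < s0 n" "\<And>n. \<not> ?P (s n)" by metis
    have "s \<longlonglongrightarrow> 0"
      by (rule real_tendsto_sandwich[OF _ _ tendsto_const s0(2)])
        (use s in \<open>auto intro!: always_eventually less_imp_le\<close>)
    from sub[OF s(1) this] obtain v r where v: "fixed f q v"
      "(\<lambda>n. LINT x|M. w (s (r n)) x * \<phi> x) \<longlonglongrightarrow> (LINT x|M. v x * \<phi> x)" using \<phi> by blast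
    have "(LINT x|M. v x * \<phi> x) = (LINT x|M. u x * \<phi> x)"
      using fixed_unique[OF q cq f v(1) u] u v(1) L2_measurable[OF \<phi>]
      by (intro integral_cong_AE) (auto simp: fixed_def dest: L2_measurable)
    with v(2) \<open>e > 0\<close> have "eventually (\<lambda>n. ?P (s (r n))) sequentially" by (auto dest: tendstoD)
    then show False using s(3) by simp
  qed
  then show ?thesis using u cq by blast
qed

end

subsection \<open>Perforated domains\<close>

lemma sigma_finite_lebesgue: "sigma_finite_measure (lebesgue :: 'a::euclidean_space measure)"
proof
  have "(\<Union>i. ball (0::'a) (real i)) = UNIV"
    by (auto simp: reals_Archimedean2)
  then show "\<exists>A. countable A \<and> A \<subseteq> sets (lebesgue :: 'a measure) \<and> \<Union> A = space lebesgue \<and>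
      (\<forall>a\<in>A. emeasure lebesgue a \<noteq> \<infinity>)"
    using emeasure_bounded_finite[OF bounded_ball]
    by (intro exI[of _ "range (\<lambda>i::nat. ball (0::'a) (real i))"]) (auto simp: less_top[symmetric])
qed

text \<open>Expand the square: by symmetry of \<open>k\<close> and Fubini the two pure square terms
  are equal, and the cross term gives the last integral. The setting is sigma-finite because the
  complement of the holes has infinite measure.\<close>

lemma (in sigma_finite_measure) half_energy:
  fixes k :: "'a \<Rightarrow> 'a \<Rightarrow> real"
  assumes k [measurable]: "case_prod k \<in> borel_measurable (M \<Otimes>\<^sub>M M)"
    and k_bounds: "\<And>x y. 0 \<le> k x y" "\<And>x y. k x y \<le> B" and sym: "\<And>x y. k x y = k y x"
    and kI: "\<And>x. x \<in> space M \<Longrightarrow> integrable M (k x)"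
    and d: "\<And>x. x \<in> space M \<Longrightarrow> (LINT y|M. k x y) \<le> D"
    and w: "integrable M w" and w2: "integrable M (\<lambda>x. (w x)\<^sup>2)"
  shows "1 / 2 * (LINT x|M. LINT y|M. k x y * (w y - w x)\<^sup>2)
    = (LINT x|M. (w x)\<^sup>2 * (LINT y|M. k x y)) - (LINT x|M. w x * (LINT y|M. k x y * w y))"
proof -
  interpret P: pair_sigma_finite M M ..
  note [measurable] = borel_measurable_integrable[OF w]
  have kx: "k x \<in> borel_measurable M" if "x \<in> space M" for x
    using measurable_Pair2[OF k that] by simp
  have kg: "integrable M (\<lambda>y. k x y * g y)" if g: "integrable M g" and x: "x \<in> space M" for x and g :: "'a \<Rightarrow> real"
  proof (rule Bochner_Integration.integrable_bound)
    show "integrable M (\<lambda>y. B * g y)" using g by simp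
    show "AE y in M. norm (k x y * g y) \<le> norm (B * g y)"
      using k_bounds order_trans[OF k_bounds] by (auto simp: abs_mult intro!: mult_right_mono)
    show "(\<lambda>y. k x y * g y) \<in> borel_measurable M" using kx[OF x] borel_measurable_integrable[OF g] by simp
  qed
  have bound: "integrable M (\<lambda>x. g x * (LINT y|M. k x y * e y))"
    if g: "integrable M g" and e: "e \<in> borel_measurable M"
      and b: "\<And>x. x \<in> space M \<Longrightarrow> \<bar>LINT y|M. k x y * e y\<bar> \<le> C" for g e :: "'a \<Rightarrow> real" and C
  proof (rule Bochner_Integration.integrable_bound)
    note [measurable] = e borel_measurable_integrable[OF g]
    show "integrable M (\<lambda>x. C * \<bar>g x\<bar>)" using g by simp
    show "AE x in M. norm (g x * (LINT y|M. k x y * e y)) \<le> norm (C * \<bar>g x\<bar>)"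
    proof (rule AE_I2)
      fix x assume "x \<in> space M"
      from mult_left_mono[OF b[OF this], of "\<bar>g x\<bar>"]
      show "norm (g x * (LINT y|M. k x y * e y)) \<le> norm (C * \<bar>g x\<bar>)"
        by (simp add: abs_mult) (smt (verit) abs_ge_zero mult.commute mult_right_mono)
    qed
    show "(\<lambda>x. g x * (LINT y|M. k x y * e y)) \<in> borel_measurable M" by measurable
  qed
  have dI: "integrable M (\<lambda>x. (w x)\<^sup>2 * (LINT y|M. k x y))"
    using bound[OF w2, of "\<lambda>_. 1" D] d Bochner_Integration.integral_nonneg[of M "k _", OF k_bounds(1)] by simp
  have TI: "integrable M (\<lambda>x. w x * (LINT y|M. k x y * w y))"
  proof (rule bound[OF w])
    fix x assume x: "x \<in> space M"
    have "\<bar>LINT y|M. k x y * w y\<bar> \<le> (LINT y|M. \<bar>k x y * w y\<bar>)" by simp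
    also have "\<dots> \<le> (LINT y|M. B * \<bar>w y\<bar>)"
      using kg[OF integrable_abs[OF w] x] w k_bounds by (intro integral_mono) (auto simp: abs_mult intro!: mult_right_mono)
    finally show "\<bar>LINT y|M. k x y * w y\<bar> \<le> (LINT y|M. B * \<bar>w y\<bar>)" .
  qed simp
  \<comment> \<open>The bound \<open>D\<close> on the mass makes
    \<open>k x y * (w x)\<^sup>2\<close> integrable on the product; symmetry then handles the term
    with \<open>w y\<close> through the same function.\<close>
  have PI: "integrable (M \<Otimes>\<^sub>M M) (\<lambda>(x, y). k x y * (w x)\<^sup>2)"
  proof (rule P.Fubini_integrable)
    show "integrable M (\<lambda>x. LINT y|M. norm (case (x, y) of (x, y) \<Rightarrow> k x y * (w x)\<^sup>2))"
      using dI k_bounds(1) by (simp add: abs_mult mult.commute)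
    show "AE x in M. integrable M (\<lambda>y. case (x, y) of (x, y) \<Rightarrow> k x y * (w x)\<^sup>2)"
      using kI by (auto intro!: AE_I2)
  qed measurable
  have G: "(LINT x|M. LINT y|M. k x y * (w y)\<^sup>2) = (LINT x|M. (w x)\<^sup>2 * (LINT y|M. k x y))"
    using P.Fubini_integral[OF PI] sym by (simp add: mult.commute)
  have GI: "integrable M (\<lambda>x. LINT y|M. k x y * (w y)\<^sup>2)"
    using P.integrable_snd[OF PI] sym by simp
  have "(LINT y|M. k x y * (w y - w x)\<^sup>2)
     = (LINT y|M. k x y * (w y)\<^sup>2) - 2 * (w x * (LINT y|M. k x y * w y)) + (w x)\<^sup>2 * (LINT y|M. k x y)"
    if x: "x \<in> space M" for x
  proof -
    have "k x y * (w y - w x)\<^sup>2 = k x y * (w y)\<^sup>2 - 2 * w x * (k x y * w y) + (w x)\<^sup>2 * k x y" for y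
      by (simp add: power2_diff algebra_simps)
    then show ?thesis using kg[OF w x] kg[OF w2 x] kI[OF x] by (simp add: mult.assoc)
  qed
  then have "(LINT x|M. LINT y|M. k x y * (w y - w x)\<^sup>2) = (LINT x|M. (LINT y|M. k x y * (w y)\<^sup>2)
      - 2 * (w x * (LINT y|M. k x y * w y)) + (w x)\<^sup>2 * (LINT y|M. k x y))"
    by (intro Bochner_Integration.integral_cong) auto
  also have "\<dots> = 2 * (LINT x|M. (w x)\<^sup>2 * (LINT y|M. k x y)) - 2 * (LINT x|M. w x * (LINT y|M. k x y * w y))"
    using GI TI dI by (simp add: G)
  finally show ?thesis by simp
qed

text \<open>Moves integrals of functions extended by zero between the perforated set, \<Omega> and
  the complement of the holes.\<close>

lemma lebesgue_on_integral_swap: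
  fixes g :: "'a::euclidean_space \<Rightarrow> real"
  assumes "S \<in> sets lebesgue" "S' \<in> sets lebesgue" "\<And>x. x \<in> S \<Longrightarrow> x \<notin> S' \<Longrightarrow> g x = 0"
    "\<And>x. x \<in> S' \<Longrightarrow> x \<notin> S \<Longrightarrow> g x = 0"
  shows "(LINT x|lebesgue_on S. g x) = (LINT x|lebesgue_on S'. g x)"
proof -
  have "(LINT x|lebesgue_on S. g x) = (LINT x|lebesgue. indicator S x *\<^sub>R g x)"
    by (rule integral_restrict_space) (use assms in simp)
  also have "\<dots> = (LINT x|lebesgue. indicator S' x *\<^sub>R g x)"
    using assms(3,4) by (intro Bochner_Integration.integral_cong) (auto simp: indicator_def)
  also have "\<dots> = (LINT x|lebesgue_on S'. g x)"
    by (rule integral_restrict_space[symmetric]) (use assms in simp)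
  finally show ?thesis .
qed

section \<open>The dispersal kernel: bounds, translates and measurability\<close>

locale dispersal_kernel =
  fixes J :: "'a::euclidean_space \<Rightarrow> real"
  assumes J_cont: "continuous_on UNIV J" and J_nonneg: "\<And>x. 0 \<le> J x"
    and J_supp: "compact (closure {x. J x \<noteq> 0})"
    and J_even: "\<And>x. J (- x) = J x" and J_int: "(LINT x|lebesgue. J x) = 1"
begin

lemma J_minus: "J (x - y) = J (y - x)"
  using J_even[of "x - y"] by simp

lemma J_borel [measurable]: "J \<in> borel_measurable borel"
  by (rule borel_measurable_continuous_onI[OF J_cont])

lemma J_shift_measurable: "(\<lambda>y. J (x - y)) \<in> borel_measurable (lebesgue_on S)"
proof -
  have "(\<lambda>y. J (x - y)) \<in> borel_measurable borel" by measurable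
  then show ?thesis by (intro measurable_restrict_space1 measurable_completion) simp
qed

lemma J_shift_measurable_lebesgue: "(\<lambda>y. J (x - y)) \<in> borel_measurable lebesgue"
  using J_shift_measurable[of x UNIV] by (simp add: lebesgue_on_UNIV_eq)

text \<open>Taken at least one so that the same constant bounds \<open>b\<close>, which is part of a
  total mass of one.\<close>

definition Jmax :: real where "Jmax = (SOME B. 1 \<le> B \<and> (\<forall>x. J x \<le> B))"

lemma Jmax: "1 \<le> Jmax" "J x \<le> Jmax"
proof -
  have "compact (J ` closure {x. J x \<noteq> 0})"
    by (rule compact_continuous_image[OF continuous_on_subset[OF J_cont] J_supp]) simp
  then obtain b where b: "\<And>y. y \<in> J ` closure {x. J x \<noteq> 0} \<Longrightarrow> norm y \<le> b"
    using compact_imp_bounded bounded_iff by metis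
  have "J x \<le> max 1 b" for x
  proof (cases "J x = 0")
    case False
    then have "J x \<in> J ` closure {x. J x \<noteq> 0}" using closure_subset by fastforce
    from b[OF this] show ?thesis by simp
  qed simp
  then have "1 \<le> max 1 b \<and> (\<forall>x. J x \<le> max 1 b)" by simp
  then have "1 \<le> Jmax \<and> (\<forall>x. J x \<le> Jmax)" unfolding Jmax_def by (rule someI)
  then show "1 \<le> Jmax" "J x \<le> Jmax" by auto
qed

lemma J_shift: "integrable lebesgue (\<lambda>y. J (x - y))" "(LINT y|lebesgue. J (x - y)) = 1"
proof -
  \<comment> \<open>A function that is not integrable has integral 0 by convention, so integral one
    implies integrability.\<close>
  have "integrable lebesgue J" using J_int not_integrable_integral_eq by fastforce
  then have I: "integrable lborel J" by (simp add: integrable_completion)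
  have i: "(LINT y|lborel. J y) = 1" using J_int by (simp add: integral_completion)
  have m[measurable]: "(\<lambda>y. J (x - y)) \<in> borel_measurable lborel" by simp
  \<comment> \<open>Translation invariance of \<open>lborel\<close> gives the claim for
    \<open>- x + y\<close>; evenness turns this into \<open>x - y\<close>.\<close>
  have "integrable (distr lborel borel ((+) (- x))) J" "integral\<^sup>L (distr lborel borel ((+) (- x))) J = 1"
    using I i by (simp_all only: lborel_distr_plus)
  then have "integrable lborel (\<lambda>y. J (- x + y))" "(LINT y|lborel. J (- x + y)) = 1"
    by (simp_all add: integrable_distr_eq integral_distr)
  moreover have "J (- x + y) = J (x - y)" for y using J_minus[of x y] by simp
  ultimately show "integrable lebesgue (\<lambda>y. J (x - y))" "(LINT y|lebesgue. J (x - y)) = 1"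
    using integrable_completion[OF m] integral_completion[OF m] by simp_all
qed

lemma J_shift_mult:
  assumes "integrable lebesgue w"
  shows "integrable lebesgue (\<lambda>y. J (x - y) * w y)"
proof (rule Bochner_Integration.integrable_bound)
  show "integrable lebesgue (\<lambda>y. Jmax * w y)" using assms by simp
  show "AE y in lebesgue. norm (J (x - y) * w y) \<le> norm (Jmax * w y)"
    using Jmax J_nonneg order_trans[OF zero_le_one Jmax(1)] by (auto simp: abs_mult intro!: mult_right_mono)
qed (use J_shift_measurable_lebesgue assms in auto)

lemma J_shift_on:
  assumes "S \<in> sets lebesgue"
  shows "integrable (lebesgue_on S) (\<lambda>y. J (x - y))" "0 \<le> (LINT y|lebesgue_on S. J (x - y))"
    "(LINT y|lebesgue_on S. J (x - y)) \<le> 1"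
proof -
  have I: "integrable lebesgue (\<lambda>y. indicator S y *\<^sub>R J (x - y))"
    by (rule integrable_mult_indicator[OF assms J_shift(1)])
  then show "integrable (lebesgue_on S) (\<lambda>y. J (x - y))"
    using assms by (simp add: integrable_restrict_space)
  show "0 \<le> (LINT y|lebesgue_on S. J (x - y))"
    by (simp add: J_nonneg)
  have "(LINT y|lebesgue. indicator S y *\<^sub>R J (x - y)) \<le> (LINT y|lebesgue. J (x - y))"
    using I J_shift(1) by (rule integral_mono) (auto simp: indicator_def J_nonneg)
  then show "(LINT y|lebesgue_on S. J (x - y)) \<le> 1"
    using assms by (simp add: integral_restrict_space J_shift(2))
qed

lemma J_prod_measurable:
  "(\<lambda>(x, y). J (x - y)) \<in> borel_measurable (lebesgue_on S \<Otimes>\<^sub>M lebesgue_on S')"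
proof -
  have [measurable]: "(\<lambda>x::'a. x) \<in> borel_measurable (lebesgue_on S)" for S
    by (intro measurable_restrict_space1 measurable_completion) simp
  show ?thesis by measurable
qed

end

section \<open>The abstract theory on a bounded domain\<close>

locale perforated_domain = dispersal_kernel J for J :: "'a::euclidean_space \<Rightarrow> real" +
  fixes \<Omega> :: "'a set" and c :: real
  assumes open_\<Omega>: "open \<Omega>" and bounded_\<Omega>: "bounded \<Omega>" and c_pos: "c > 0"
begin

lemma \<Omega>_lmeasurable: "\<Omega> \<in> lmeasurable"
  using open_\<Omega> bounded_\<Omega> by (rule lmeasurable_open[rotated])

lemma \<Omega>_sets [measurable, simp]: "\<Omega> \<in> sets lebesgue" "- \<Omega> \<in> sets lebesgue"
  using fmeasurableD[OF \<Omega>_lmeasurable] sets.compl_sets[of \<Omega> "lebesgue :: 'a measure"]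
  by (auto simp: Compl_eq_Diff_UNIV)

definition b :: "'a \<Rightarrow> real" where "b x = (LINT y|lebesgue_on (- \<Omega>). J (x - y))"

sublocale nonlocal_kernel "lebesgue_on \<Omega>" "\<lambda>x y. J (x - y)" b Jmax c
proof -
  interpret finite_measure "lebesgue_on \<Omega>" by (rule finite_measure_lebesgue_on[OF \<Omega>_lmeasurable])
  show "nonlocal_kernel (lebesgue_on \<Omega>) (\<lambda>x y. J (x - y)) b Jmax c"
  proof
    interpret C: sigma_finite_measure "lebesgue_on (- \<Omega>)"
      by (rule sigma_finite_measure_restrict_space[OF sigma_finite_lebesgue]) simp
    have "(\<lambda>x. LINT y|lebesgue_on (- \<Omega>). J (x - y)) \<in> borel_measurable (lebesgue_on \<Omega>)"
      by (rule C.borel_measurable_lebesgue_integral[OF J_prod_measurable])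
    then show "b \<in> borel_measurable (lebesgue_on \<Omega>)" by (simp add: b_def[abs_def])
    show "0 \<le> b x" "b x \<le> Jmax" for x
      using J_shift_on[of "- \<Omega>" x] Jmax(1) by (auto simp: b_def)
  qed (use J_prod_measurable J_nonneg Jmax c_pos in auto)
qed

text \<open>Arzela-Ascoli on the compact set \<open>closure \<Omega>\<close>: the L1 bound on
  \<open>w n\<close> bounds the images by \<open>Jmax * C\<close>, and uniform continuity of
  \<open>J\<close> makes them equicontinuous uniformly in \<open>n\<close>.\<close>

sublocale compact_nonlocal_kernel "lebesgue_on \<Omega>" "\<lambda>x y. J (x - y)" b Jmax c
proof
  fix w :: "nat \<Rightarrow> 'a \<Rightarrow> real" and C :: real
  assume w: "\<And>n. integrable (lebesgue_on \<Omega>) (w n)" and C: "\<And>n. (LINT x|lebesgue_on \<Omega>. \<bar>w n x\<bar>) \<le> C"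
  have kI: "integrable (lebesgue_on \<Omega>) (\<lambda>y. J (x - y) * w n y)" for x n
    by (rule Bochner_Integration.integrable_bound[of _ "\<lambda>y. Jmax * w n y"])
      (use w Jmax J_nonneg order_trans[OF zero_le_one Jmax(1)] J_shift_measurable in
        \<open>auto simp: abs_mult intro!: mult_right_mono AE_I2\<close>)
  have C0: "0 \<le> C" using C[of 0] by (smt (verit) Bochner_Integration.integral_nonneg abs_ge_zero)
  let ?F = "\<lambda>n x. LINT y|lebesgue_on \<Omega>. J (x - y) * w n y"
  \<comment> \<open>\<open>K\<close> is compact and contains every argument \<open>x - y\<close>
    that occurs.\<close>
  define K where "K = {x - y | x y. x \<in> closure \<Omega> \<and> y \<in> closure \<Omega>}"
  have cl: "compact (closure \<Omega>)" using bounded_\<Omega> by simp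
  have "compact K" unfolding K_def by (rule compact_differences[OF cl cl])
  then have uc: "uniformly_continuous_on K J"
    by (rule compact_uniformly_continuous[OF continuous_on_subset[OF J_cont], rotated]) simp
  obtain g and r :: "nat \<Rightarrow> nat" where "strict_mono r"
    and g: "\<And>e. 0 < e \<Longrightarrow> \<exists>N. \<forall>n x. n \<ge> N \<and> x \<in> closure \<Omega> \<longrightarrow> norm (?F (r n) x - g x) < e"
  proof (rule Arzela_Ascoli[OF cl, of ?F "Jmax * C"])
    show "norm (?F n x) \<le> Jmax * C" for n x
    proof -
      have "norm (?F n x) \<le> (LINT y|lebesgue_on \<Omega>. \<bar>J (x - y) * w n y\<bar>)"
        using integral_abs_bound by simp
      also have "\<dots> \<le> (LINT y|lebesgue_on \<Omega>. Jmax * \<bar>w n y\<bar>)"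
        using integrable_abs[OF kI[of x n]] w
        by (intro integral_mono) (auto simp: abs_mult J_nonneg Jmax intro!: mult_right_mono)
      also have "\<dots> \<le> Jmax * C" using C[of n] Jmax(1) by simp
      finally show ?thesis .
    qed
    fix x and e :: real assume x: "x \<in> closure \<Omega>" and e: "0 < e"
    \<comment> \<open>The divisor \<open>C + 1\<close> is positive even for \<open>C = 0\<close> and
      makes the final estimate strict: \<open>e / (C + 1) * C < e\<close>.\<close>
    have "0 < e / (C + 1)" using e C0 by simp
    then obtain d where d: "d > 0"
      "\<And>z z'. z \<in> K \<Longrightarrow> z' \<in> K \<Longrightarrow> dist z' z < d \<Longrightarrow> dist (J z') (J z) < e / (C + 1)"
      using uc unfolding uniformly_continuous_on_def by meson
    have "norm (?F n x - ?F n x') < e" if x': "x' \<in> closure \<Omega>" "norm (x - x') < d" for n x'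
    proof -
      have Jd: "\<bar>J (x - y) - J (x' - y)\<bar> \<le> e / (C + 1)" if "y \<in> \<Omega>" for y
      proof -
        have "y \<in> closure \<Omega>" using that closure_subset by blast
        then have "x - y \<in> K" "x' - y \<in> K" using x x' by (auto simp: K_def)
        moreover have "dist (x - y) (x' - y) < d" using x'(2) by (simp add: dist_norm)
        ultimately show ?thesis using d(2)[of "x' - y" "x - y"] by (simp add: dist_real_def)
      qed
      have "?F n x - ?F n x' = (LINT y|lebesgue_on \<Omega>. (J (x - y) - J (x' - y)) * w n y)"
        using kI by (simp add: left_diff_distrib)
      also have "norm \<dots> \<le> (LINT y|lebesgue_on \<Omega>. \<bar>(J (x - y) - J (x' - y)) * w n y\<bar>)"
        using integral_abs_bound by simp
      also have "\<dots> \<le> (LINT y|lebesgue_on \<Omega>. e / (C + 1) * \<bar>w n y\<bar>)"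
      proof (rule integral_mono)
        have "integrable (lebesgue_on \<Omega>) (\<lambda>y. (J (x - y) - J (x' - y)) * w n y)"
          using kI by (simp add: left_diff_distrib)
        then show "integrable (lebesgue_on \<Omega>) (\<lambda>y. \<bar>(J (x - y) - J (x' - y)) * w n y\<bar>)" by simp
        show "\<bar>(J (x - y) - J (x' - y)) * w n y\<bar> \<le> e / (C + 1) * \<bar>w n y\<bar>"
          if "y \<in> space (lebesgue_on \<Omega>)" for y
          unfolding abs_mult using Jd[of y] that by (intro mult_right_mono) auto
      qed (use w in simp)
      also have "\<dots> \<le> e / (C + 1) * C" using mult_left_mono[OF C[of n], of "e / (C + 1)"] C0 e by simp
      also have "\<dots> < e" using C0 e by (simp add: field_simps)
      finally show ?thesis .
    qed
    then show "\<exists>d>0. \<forall>n y. y \<in> closure \<Omega> \<and> norm (x - y) < d \<longrightarrow> norm (?F n x - ?F n y) < e"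
      using d(1) by blast
  qed (blast intro: that)
  moreover have "\<forall>x\<in>space (lebesgue_on \<Omega>). (\<lambda>n. ?F (r n) x) \<longlonglongrightarrow> g x"
  proof
    fix x assume "x \<in> space (lebesgue_on \<Omega>)"
    then have "x \<in> closure \<Omega>" using closure_subset by auto
    then show "(\<lambda>n. ?F (r n) x) \<longlonglongrightarrow> g x"
      unfolding LIMSEQ_iff using g by blast
  qed
  ultimately show "\<exists>g (r :: nat \<Rightarrow> nat). strict_mono r \<and>
      (\<forall>x\<in>space (lebesgue_on \<Omega>). (\<lambda>n. T (w (r n)) x) \<longlonglongrightarrow> g x)"
    unfolding T_def by blast
qed

end

section \<open>Restriction and extension by zero\<close>

lemma integrable_lebesgue_onI:
  fixes g :: "'a::euclidean_space \<Rightarrow> real"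
  assumes "S \<in> sets lebesgue" "integrable lebesgue g"
  shows "integrable (lebesgue_on S) g"
  using integrable_mult_indicator[OF assms] assms(1) by (simp add: integrable_restrict_space)

lemma integrable_lebesgue_on_extend:
  fixes g :: "'a::euclidean_space \<Rightarrow> real"
  assumes "S \<in> sets lebesgue" "A \<in> sets lebesgue" "A \<subseteq> S" "integrable (lebesgue_on S) g"
  shows "integrable lebesgue (\<lambda>x. indicator A x * g x)"
proof -
  have "integrable lebesgue (\<lambda>x. indicator S x *\<^sub>R g x)"
    using assms by (simp add: integrable_restrict_space)
  from integrable_mult_indicator[OF assms(2) this] show ?thesis
    using assms(3) by (elim back_subst[where P = "integrable lebesgue"]) (auto simp: fun_eq_iff split: split_indicator)
qed

lemma L2_lebesgue_on_extend:
  fixes g :: "'a::euclidean_space \<Rightarrow> real"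
  assumes S: "S \<in> sets lebesgue" and A: "A \<in> sets lebesgue" "A \<subseteq> S" and g: "g \<in> L2 (lebesgue_on S)"
  shows "(\<lambda>x. indicator A x * g x) \<in> L2 lebesgue"
proof -
  \<comment> \<open>The values of \<open>g\<close> outside \<open>S\<close> are arbitrary, so
    measurability on the whole space is available only after multiplication by the indicator of
    \<open>S\<close>.\<close>
  have "(\<lambda>x. indicator S x *\<^sub>R g x) \<in> borel_measurable lebesgue"
    using L2_measurable[OF g] S by (simp add: borel_measurable_restrict_space_iff)
  then have "(\<lambda>x. indicator A x * (indicator S x *\<^sub>R g x)) \<in> borel_measurable lebesgue"
    using A(1) by simp
  also have "(\<lambda>x. indicator A x * (indicator S x *\<^sub>R g x)) = (\<lambda>x. indicator A x * g x)"
    using A(2) by (auto simp: fun_eq_iff split: split_indicator)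
  finally have 1: "(\<lambda>x. indicator A x * g x) \<in> borel_measurable lebesgue" .
  have "integrable lebesgue (\<lambda>x. indicator A x * (g x)\<^sup>2)"
    by (rule integrable_lebesgue_on_extend[OF S A L2_integrable_square[OF g]])
  moreover have "indicator A x * (g x)\<^sup>2 = (indicator A x * g x)\<^sup>2" for x by (simp add: indicator_def)
  ultimately show ?thesis using 1 by (simp add: L2_def)
qed

lemma L2_lebesgue_onI:
  fixes g :: "'a::euclidean_space \<Rightarrow> real"
  assumes "S \<in> sets lebesgue" "g \<in> L2 lebesgue"
  shows "g \<in> L2 (lebesgue_on S)"
  using assms integrable_lebesgue_onI[OF assms(1), of "\<lambda>x. (g x)\<^sup>2"]
  by (auto simp: L2_def intro: measurable_restrict_space1)

section \<open>From the perforated problem to weights\<close>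

context perforated_domain
begin

declare Compl_Diff_eq [simp del] \<comment> \<open>keeps the perforated space \<open>- (\<Omega> - O')\<close> intact\<close>

lemma hole_sets:
  assumes "open O'"
  shows "O' \<in> sets lebesgue" "- (\<Omega> - O') \<in> sets lebesgue"
proof -
  show O': "O' \<in> sets lebesgue" using assms by simp
  have "- (\<Omega> - O') = - \<Omega> \<union> O'" by auto
  then show "- (\<Omega> - O') \<in> sets lebesgue" using O' by (simp add: sets.Un)
qed

lemma weight_indicator: "open O' \<Longrightarrow> weight (lebesgue_on \<Omega>) (indicator O')"
  using measurable_restrict_space1[OF borel_measurable_indicator[OF hole_sets(1)[of O']]]
  by (simp add: weight_def indicator_le_1)

text \<open>The complement of the holes is the disjoint union of \<open>- \<Omega>\<close> and
  \<open>O'\<close>; these contribute the two terms of \<open>h\<close>.\<close>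

lemma perforated_mass:
  assumes "open O'" "O' \<subseteq> \<Omega>"
  shows "(LINT y|lebesgue_on (- (\<Omega> - O')). J (x - y)) = h (indicator O') x"
proof -
  note S = hole_sets[OF assms(1)]
  have "(LINT y|lebesgue_on (- (\<Omega> - O')). J (x - y))
      = (LINT y|lebesgue. indicator (- \<Omega>) y *\<^sub>R J (x - y) + indicator O' y *\<^sub>R J (x - y))"
    using S assms(2) by (subst integral_restrict_space)
      (auto intro!: Bochner_Integration.integral_cong simp: indicator_def)
  also have "\<dots> = (LINT y|lebesgue. indicator (- \<Omega>) y *\<^sub>R J (x - y)) + (LINT y|lebesgue. indicator O' y *\<^sub>R J (x - y))"
    by (intro Bochner_Integration.integral_add integrable_mult_indicator J_shift S(1)) simp
  also have "(LINT y|lebesgue. indicator (- \<Omega>) y *\<^sub>R J (x - y)) = b x"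
    by (simp add: b_def integral_restrict_space)
  also have "(LINT y|lebesgue. indicator O' y *\<^sub>R J (x - y)) = T (indicator O') x"
    unfolding T_def using assms(2)
    by (subst integral_restrict_space) (auto intro!: Bochner_Integration.integral_cong simp: indicator_def)
  finally show ?thesis by (simp add: h_def)
qed

text \<open>Clears the denominator in \<open>lambda1\<close>. A function vanishing a.e. is not a
  competitor there, but then the left-hand side is zero and the energy is nonnegative.\<close>

lemma energy_ge:
  assumes "open O'" "O' \<subseteq> \<Omega>" and l: "ereal c \<le> lambda1 J \<Omega> O'"
    and w: "w \<in> L2 lebesgue" "\<And>x. x \<notin> O' \<Longrightarrow> w x = 0"
  shows "c * (LINT x|lebesgue_on O'. (w x)\<^sup>2) \<le>
    1 / 2 * (LINT x|lebesgue_on (- (\<Omega> - O')). LINT y|lebesgue_on (- (\<Omega> - O')). J (x - y) * (w y - w x)\<^sup>2)"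
    (is "_ * ?D \<le> ?E")
proof (cases "AE x in lebesgue_on (- (\<Omega> - O')). w x = 0")
  case True
  have "?D = (LINT x|lebesgue_on (- (\<Omega> - O')). (w x)\<^sup>2)"
    by (rule lebesgue_on_integral_swap) (use hole_sets[OF assms(1)] assms(2) w(2) in auto)
  also have "\<dots> = 0"
    by (rule integral_eq_zero_AE) (use True in auto)
  moreover have "0 \<le> ?E"
    by (intro mult_nonneg_nonneg Bochner_Integration.integral_nonneg) (auto simp: J_nonneg)
  ultimately show ?thesis by simp
next
  case False
  have "w \<in> W_space \<Omega> O'"
    unfolding W_space_def L2_on_eq using L2_lebesgue_onI[OF hole_sets(2)[OF assms(1)] w(1)] w(2) assms(2)
    by (auto intro!: AE_I2 w(2) dest: subsetD)
  with False have "lambda1 J \<Omega> O' \<le> ereal (?E / ?D)"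
    unfolding lambda1_def by (intro INF_lower) auto
  with l have ED: "c \<le> ?E / ?D" using order_trans by fastforce
  \<comment> \<open>Division by zero yields 0, so a vanishing denominator would contradict
    \<open>0 < c\<close> and \<open>c \<le> ?E / ?D\<close>.\<close>
  have "?D \<noteq> 0" using ED c_pos by auto
  moreover have "0 \<le> ?D" by simp
  ultimately have "0 < ?D" by linarith
  with ED show ?thesis by (simp add: pos_le_divide_eq)
qed

text \<open>The competitor \<open>w\<close> is \<open>\<phi>\<close> cut off to \<open>O'\<close>
  and extended by zero. \<open>half_energy\<close> evaluates its energy on the complement of the
  holes; both resulting outer integrals carry a factor \<open>w\<close> and so transfer to
  \<Omega>.\<close>

lemma coercive_indicator:
  assumes O': "open O'" "O' \<subseteq> \<Omega>" and l: "ereal c \<le> lambda1 J \<Omega> O'"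
  shows "coercive (indicator O')"
  unfolding coercive_def
proof
  fix \<phi> assume \<phi>: "\<phi> \<in> L2 (lebesgue_on \<Omega>)"
  note S = hole_sets[OF O'(1)]
  define w where "w x = indicator O' x * \<phi> x" for x
  have w0: "w x = 0" if "x \<notin> O'" for x using that by (simp add: w_def)
  have w: "w \<in> L2 lebesgue"
    unfolding w_def[abs_def] by (rule L2_lebesgue_on_extend[OF \<Omega>_sets(1) S(1) O'(2) \<phi>])
  have wI: "integrable lebesgue w"
    unfolding w_def[abs_def] by (rule integrable_lebesgue_on_extend[OF \<Omega>_sets(1) S(1) O'(2) L2_integrable[OF \<phi>]])
  have w2: "(w x)\<^sup>2 = indicator O' x * (\<phi> x)\<^sup>2" for x by (simp add: w_def indicator_def)
  let ?K = "- (\<Omega> - O')"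
  interpret K: sigma_finite_measure "lebesgue_on ?K"
    by (rule sigma_finite_measure_restrict_space[OF sigma_finite_lebesgue]) (use S in simp)
  have "1 / 2 * (LINT x|lebesgue_on ?K. LINT y|lebesgue_on ?K. J (x - y) * (w y - w x)\<^sup>2)
    = (LINT x|lebesgue_on ?K. (w x)\<^sup>2 * (LINT y|lebesgue_on ?K. J (x - y)))
      - (LINT x|lebesgue_on ?K. w x * (LINT y|lebesgue_on ?K. J (x - y) * w y))"
    by (rule K.half_energy[where B = Jmax and D = 1])
      (use J_prod_measurable J_nonneg Jmax J_minus J_shift_on[OF S(2)] integrable_lebesgue_onI[OF S(2)]
        wI L2_integrable_square[OF w] in auto)
  also have "(LINT x|lebesgue_on ?K. (w x)\<^sup>2 * (LINT y|lebesgue_on ?K. J (x - y)))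
      = (LINT x|lebesgue_on \<Omega>. (w x)\<^sup>2 * (LINT y|lebesgue_on ?K. J (x - y)))"
    by (rule lebesgue_on_integral_swap) (use S O' w0 in auto)
  also have "\<dots> = (LINT x|lebesgue_on \<Omega>. indicator O' x * ((\<phi> x)\<^sup>2 * h (indicator O') x))"
    by (simp add: perforated_mass[OF O'] w2 mult.assoc)
  also have "(LINT x|lebesgue_on ?K. w x * (LINT y|lebesgue_on ?K. J (x - y) * w y))
      = (LINT x|lebesgue_on \<Omega>. w x * (LINT y|lebesgue_on ?K. J (x - y) * w y))"
    by (rule lebesgue_on_integral_swap) (use S O' w0 in auto)
  also have "\<dots> = (LINT x|lebesgue_on \<Omega>. indicator O' x * (\<phi> x * T (\<lambda>y. indicator O' y * \<phi> y) x))"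
  proof -
    have "(LINT y|lebesgue_on ?K. J (x - y) * w y) = T w x" for x
      unfolding T_def by (rule lebesgue_on_integral_swap) (use S O' w0 in auto)
    then show ?thesis by (simp add: w_def[abs_def] mult.assoc)
  qed
  finally have E: "1 / 2 * (LINT x|lebesgue_on ?K. LINT y|lebesgue_on ?K. J (x - y) * (w y - w x)\<^sup>2) =
    (LINT x|lebesgue_on \<Omega>. indicator O' x * ((\<phi> x)\<^sup>2 * h (indicator O') x))
    - (LINT x|lebesgue_on \<Omega>. indicator O' x * (\<phi> x * T (\<lambda>y. indicator O' y * \<phi> y) x))" .
  have "(LINT x|lebesgue_on O'. (w x)\<^sup>2) = (LINT x|lebesgue_on \<Omega>. (w x)\<^sup>2)"
    by (rule lebesgue_on_integral_swap) (use S O' w0 in auto)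
  then show "c * (LINT x|lebesgue_on \<Omega>. indicator O' x * (\<phi> x)\<^sup>2)
    \<le> (LINT x|lebesgue_on \<Omega>. indicator O' x * ((\<phi> x)\<^sup>2 * h (indicator O') x))
    - (LINT x|lebesgue_on \<Omega>. indicator O' x * (\<phi> x * T (\<lambda>y. indicator O' y * \<phi> y) x))"
    using energy_ge[OF O' l w w0] unfolding E w2 by simp
qed

text \<open>Splitting \<open>u y - u x\<close> under the integral separates \<open>T v\<close> from
  the mass of \<open>J\<close> over the complement of the holes, which is
  \<open>h (indicator O')\<close>. The extension \<open>v\<close> vanishes in the holes, as
  \<open>fixedI\<close> demands.\<close>

lemma solution_fixed:
  assumes O': "open O'" "O' \<subseteq> \<Omega>" and co: "coercive (indicator O')" and sol: "is_solution J f \<Omega> O' u"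
  shows "fixed f (indicator O') (zero_ext (- (\<Omega> - O')) u)"
proof -
  let ?K = "- (\<Omega> - O')"
  note S = hole_sets[OF O'(1)]
  define v where "v = zero_ext ?K u"
  have v_ind: "v = (\<lambda>x. indicator ?K x * u x)" by (auto simp: v_def zero_ext_def indicator_def)
  have vu: "v x = u x" if "x \<in> ?K" for x using that unfolding v_def zero_ext_def by (rule if_P)
  have uL: "u \<in> L2 (lebesgue_on ?K)" and u0: "AE x in lebesgue_on (- \<Omega>). u x = 0"
    and eq: "AE x in lebesgue_on O'. f x = (LINT y|lebesgue_on ?K. J (x - y) * (u y - u x))"
    using sol by (auto simp: is_solution_def W_space_def L2_on_eq)
  have vL: "v \<in> L2 lebesgue"
    unfolding v_ind by (rule L2_lebesgue_on_extend[OF S(2) S(2) subset_refl uL])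
  note [measurable] = L2_measurable[OF vL]
  have vM: "v \<in> L2 (lebesgue_on \<Omega>)" by (rule L2_lebesgue_onI[OF \<Omega>_sets(1) vL])
  have "AE x in lebesgue. x \<in> - \<Omega> \<longrightarrow> u x = 0" using u0 by (simp add: AE_restrict_space_iff)
  then have v0: "AE x in lebesgue. indicator \<Omega> x * v x = v x"
    by eventually_elim (auto simp: v_ind indicator_def)
  \<comment> \<open>On a space of infinite measure square-integrability does not give integrability;
    here it does because \<open>v\<close> vanishes a.e. outside the bounded set \<Omega>.\<close>
  have "integrable lebesgue (\<lambda>x. indicator \<Omega> x * v x)"
    by (rule integrable_lebesgue_on_extend[OF \<Omega>_sets(1) \<Omega>_sets(1) subset_refl L2_integrable[OF vM]])
  then have vI: "integrable lebesgue v"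
    by (rule integrable_cong_AE_imp) (use v0 in auto)
  have uT: "(LINT y|lebesgue_on ?K. J (x - y) * u y) = T v x"
    and uI: "integrable (lebesgue_on ?K) (\<lambda>y. J (x - y) * u y)" for x
  proof -
    have "(LINT y|lebesgue_on ?K. J (x - y) * u y) = (LINT y|lebesgue_on ?K. J (x - y) * v y)"
      by (intro Bochner_Integration.integral_cong) (auto simp: vu)
    also have "\<dots> = (LINT y|lebesgue. J (x - y) * v y)"
      using S(2) by (subst integral_restrict_space)
        (auto intro!: Bochner_Integration.integral_cong simp: v_ind indicator_def)
    also have "\<dots> = (LINT y|lebesgue. indicator \<Omega> y *\<^sub>R (J (x - y) * v y))"
    proof (rule integral_cong_AE)
      show "AE y in lebesgue. J (x - y) * v y = indicator \<Omega> y *\<^sub>R (J (x - y) * v y)"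
        using v0 by eventually_elim (simp add: mult.left_commute)
    qed (use J_shift_measurable_lebesgue in auto)
    finally show "(LINT y|lebesgue_on ?K. J (x - y) * u y) = T v x"
      by (simp add: T_def integral_restrict_space)
    have "integrable (lebesgue_on ?K) (\<lambda>y. J (x - y) * v y)"
      by (rule integrable_lebesgue_onI[OF S(2) J_shift_mult[OF vI]])
    then show "integrable (lebesgue_on ?K) (\<lambda>y. J (x - y) * u y)"
      by (rule Bochner_Integration.integrable_cong[THEN iffD1, rotated 2]) (auto simp: vu)
  qed
  have rhs: "(LINT y|lebesgue_on ?K. J (x - y) * (u y - u x)) = T v x - u x * h (indicator O') x" for x
  proof -
    have "(LINT y|lebesgue_on ?K. J (x - y) * (u y - u x))
        = (LINT y|lebesgue_on ?K. J (x - y) * u y - u x * J (x - y))"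
      by (simp add: right_diff_distrib mult.commute)
    also have "\<dots> = T v x - u x * h (indicator O') x"
      using uI J_shift_on(1)[OF S(2)] by (simp add: uT perforated_mass[OF O'])
    finally show ?thesis .
  qed
  have "fixed f (indicator O') v"
  proof (rule fixedI[OF weight_indicator[OF O'(1)] co vM])
    have z: "v x = 0" if "x \<in> \<Omega>" "x \<notin> O'" for x using that by (auto simp: v_def zero_ext_def)
    then show "AE x in lebesgue_on \<Omega>. indicator O' x = (0::real) \<longrightarrow> v x = 0"
      by (auto intro!: AE_I2 simp: indicator_def)
    have "AE x in lebesgue. x \<in> O' \<longrightarrow> f x = T v x - u x * h (indicator O') x"
      using eq S(1) by (simp add: AE_restrict_space_iff rhs)
    then have "AE x in lebesgue. x \<in> \<Omega> \<longrightarrow> indicator O' x * f x = indicator O' x * T v x - h (indicator O') x * v x"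
    proof eventually_elim
      case (elim x)
      show ?case
      proof (cases "x \<in> O'")
        case True
        then have "v x = u x" by (intro vu) auto
        with True elim show ?thesis by (simp add: mult.commute)
      qed (use z in auto)
    qed
    then show "AE x in lebesgue_on \<Omega>. indicator O' x * f x = indicator O' x * T v x - h (indicator O') x * v x"
      by (simp add: AE_restrict_space_iff)
  qed
  then show ?thesis by (simp add: v_def)
qed

text \<open>The factor \<open>1 - indicator \<Omega> y + X y\<close> is one a.e. outside \<Omega>,
  where it yields \<open>b\<close>, and equals \<open>X y\<close> inside, where it yields
  \<open>T X'\<close>.\<close>

lemma Lam_eq:
  assumes [measurable]: "X \<in> borel_measurable lebesgue" "X' \<in> borel_measurable lebesgue"
    and X': "AE x in lebesgue. X' x = X x" "\<And>x. \<bar>X' x\<bar> \<le> 1" and X0: "AE x in lebesgue_on (- \<Omega>). X x = 0"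
  shows "Lam J \<Omega> X x = h X' x - X x"
proof -
  note [measurable] = J_shift_measurable_lebesgue
  have X0': "AE x in lebesgue. x \<in> - \<Omega> \<longrightarrow> X x = 0" using X0 by (simp add: AE_restrict_space_iff)
  have I: "integrable lebesgue (\<lambda>y. J (x - y) * X' y)"
  proof (rule Bochner_Integration.integrable_bound[OF J_shift(1)[of x]])
    show "AE y in lebesgue. norm (J (x - y) * X' y) \<le> norm (J (x - y))"
      using mult_left_mono[OF X'(2) J_nonneg] by (auto simp: abs_mult J_nonneg)
  qed simp
  have "(LINT y|lebesgue. J (x - y) * (1 - indicator \<Omega> y + X y))
     = (LINT y|lebesgue. indicator (- \<Omega>) y *\<^sub>R J (x - y) + indicator \<Omega> y *\<^sub>R (J (x - y) * X' y))"
  proof (rule integral_cong_AE)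
    show "AE y in lebesgue. J (x - y) * (1 - indicator \<Omega> y + X y)
        = indicator (- \<Omega>) y *\<^sub>R J (x - y) + indicator \<Omega> y *\<^sub>R (J (x - y) * X' y)"
      using X0' X'(1) by eventually_elim (auto simp: indicator_def)
  qed measurable
  also have "\<dots> = (LINT y|lebesgue. indicator (- \<Omega>) y *\<^sub>R J (x - y))
      + (LINT y|lebesgue. indicator \<Omega> y *\<^sub>R (J (x - y) * X' y))"
    by (intro Bochner_Integration.integral_add integrable_mult_indicator J_shift I) simp_all
  also have "\<dots> = h X' x"
    by (simp add: h_def b_def T_def integral_restrict_space)
  finally show ?thesis by (simp add: Lam_def)
qed

end

section \<open>Identification of the weak limit for the perforated problem\<close>

theorem theorem1p2:
  fixes \<Omega> :: "'a::euclidean_space set"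
    and \<Omega>e :: "real \<Rightarrow> 'a set"
    and X J f :: "'a \<Rightarrow> real"
    and u :: "real \<Rightarrow> 'a \<Rightarrow> real"
    and c :: real
  assumes "open \<Omega>" and "bounded \<Omega>" and "connected \<Omega>" and "\<Omega> \<noteq> {}"
    and "\<And>\<epsilon>. \<epsilon> > 0 \<Longrightarrow> open (\<Omega>e \<epsilon>) \<and> bounded (\<Omega>e \<epsilon>) \<and> \<Omega>e \<epsilon> \<subseteq> \<Omega>"
    and "X \<in> Linf_on UNIV"
    and "AE x in lebesgue. 0 \<le> X x \<and> X x \<le> 1"
    and "AE x in lebesgue_on (- \<Omega>). X x = 0"
    and "continuous_on UNIV J"
    and "\<And>x. 0 \<le> J x"
    and "compact (closure {x. J x \<noteq> 0})"
    and "J 0 > 0"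
    and "\<And>x. J (- x) = J x"
    and "(LINT x|lebesgue. J x) = 1"
    and "f \<in> L2_on \<Omega>"
    and "weak_star_Linf \<Omega> (\<lambda>\<epsilon>. indicator (\<Omega>e \<epsilon>)) X"
    and "c > 0"
    and "\<And>\<epsilon>. \<epsilon> > 0 \<Longrightarrow> lambda1 J \<Omega> (\<Omega>e \<epsilon>) \<ge> ereal c"
    and "\<And>\<epsilon>. \<epsilon> > 0 \<Longrightarrow> is_solution J f \<Omega> (\<Omega>e \<epsilon>) (u \<epsilon>)"
  shows "\<exists>us. us \<in> L2_on \<Omega> \<and> (\<forall>x\<in>- \<Omega>. us x = 0) \<and>
      weak_L2 \<Omega> (\<lambda>\<epsilon>. zero_ext (- (\<Omega> - \<Omega>e \<epsilon>)) (u \<epsilon>)) us \<and>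
      ((AE x in lebesgue. X x = 0) \<and>
         (\<exists>m>0. \<forall>x\<in>\<Omega>. (LINT y|lebesgue_on (- \<Omega>). J (x - y)) \<ge> m)
         \<longrightarrow> (AE x in lebesgue. us x = 0)) \<and>
      (\<not> (AE x in lebesgue. X x = 0)
         \<longrightarrow> Lam J \<Omega> X \<in> Linf_on \<Omega> \<and>
             (AE x in lebesgue_on \<Omega>.
                X x * f x = X x * (LINT y|lebesgue. J (x - y) * (us y - us x)) - Lam J \<Omega> X x * us x))"
proof -
  interpret perforated_domain J \<Omega> c
    by standard (use assms in auto)
  have \<Omega>e: "open (\<Omega>e \<epsilon>)" "\<Omega>e \<epsilon> \<subseteq> \<Omega>" if "\<epsilon> > 0" for \<epsilon> using assms(5)[OF that] by auto
  have Xm[measurable]: "X \<in> borel_measurable lebesgue"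
    using assms(6) by (simp add: Linf_on_def lebesgue_on_UNIV_eq)
  \<comment> \<open>\<open>X\<close> takes values in \<open>[0, 1]\<close> only almost everywhere, whereas weights do so everywhere.\<close>
  define Y where "Y x = max 0 (min 1 (X x))" for x
  have Ym[measurable]: "Y \<in> borel_measurable lebesgue" unfolding Y_def[abs_def] by measurable
  have Y: "weight (lebesgue_on \<Omega>) Y"
    using Ym by (auto simp: weight_def Y_def intro: measurable_restrict_space1)
  have YX: "AE x in lebesgue. Y x = X x"
    using assms(7) by eventually_elim (simp add: Y_def)
  then have YX\<Omega>: "AE x in lebesgue_on \<Omega>. Y x = X x"
    by (auto simp: AE_restrict_space_iff elim!: eventually_mono)
  have f: "f \<in> L2 (lebesgue_on \<Omega>)" using assms(15) by (simp add: L2_on_eq)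
  have co: "coercive (indicator (\<Omega>e \<epsilon>))" if "\<epsilon> > 0" for \<epsilon>
    by (rule coercive_indicator[OF \<Omega>e[OF that] assms(18)[OF that]])
  have XY: "(LINT x|lebesgue_on \<Omega>. X x * \<psi> x) = (LINT x|lebesgue_on \<Omega>. Y x * \<psi> x)"
    if "integrable (lebesgue_on \<Omega>) \<psi>" for \<psi>
    using YX\<Omega> measurable_restrict_space1[OF Xm] measurable_restrict_space1[OF Ym] that
    by (intro integral_cong_AE) auto
  obtain w where w: "fixed f Y w" "coercive Y"
    and lim: "\<forall>\<phi>\<in>L2 (lebesgue_on \<Omega>).
      ((\<lambda>\<epsilon>. LINT x|lebesgue_on \<Omega>. zero_ext (- (\<Omega> - \<Omega>e \<epsilon>)) (u \<epsilon>) x * \<phi> x)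
        \<longlongrightarrow> (LINT x|lebesgue_on \<Omega>. w x * \<phi> x)) (at_right 0)"
  proof (rule exE[OF fixed_weak_limit[where p = "\<lambda>\<epsilon>. indicator (\<Omega>e \<epsilon>)" and q = Y and f = f
      and w = "\<lambda>\<epsilon>. zero_ext (- (\<Omega> - \<Omega>e \<epsilon>)) (u \<epsilon>)"]])
    show "weight (lebesgue_on \<Omega>) (indicator (\<Omega>e \<epsilon>))" if "\<epsilon> > 0" for \<epsilon>
      by (rule weight_indicator[OF \<Omega>e(1)[OF that]])
    show "((\<lambda>\<epsilon>. LINT x|lebesgue_on \<Omega>. indicator (\<Omega>e \<epsilon>) x * \<psi> x)
        \<longlongrightarrow> (LINT x|lebesgue_on \<Omega>. Y x * \<psi> x)) (at_right 0)"
      if "integrable (lebesgue_on \<Omega>) \<psi>" for \<psi>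
      using assms(16) that unfolding XY[OF that, symmetric] weak_star_Linf_def by blast
    show "fixed f (indicator (\<Omega>e \<epsilon>)) (zero_ext (- (\<Omega> - \<Omega>e \<epsilon>)) (u \<epsilon>))" if "\<epsilon> > 0" for \<epsilon>
      by (rule solution_fixed[OF \<Omega>e[OF that] co[OF that] assms(19)[OF that]])
  qed (use Y f co in \<open>auto simp: indicator_def\<close>)
  have wL: "w \<in> L2 (lebesgue_on \<Omega>)" using w(1) by (simp add: fixed_def)
  \<comment> \<open>\<open>w\<close> is meaningful on \<Omega> only; the cut-off makes
    \<open>us\<close> vanish at every exterior point and integrable on the whole space.\<close>
  define us where "us x = indicator \<Omega> x * w x" for x
  have us_w: "us x = w x" if "x \<in> \<Omega>" for x using that by (simp add: us_def)
  have us_0: "us x = 0" if "x \<notin> \<Omega>" for x using that by (simp add: us_def)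
  have usL: "us \<in> L2 lebesgue"
    unfolding us_def[abs_def] by (rule L2_lebesgue_on_extend[OF \<Omega>_sets(1) \<Omega>_sets(1) subset_refl wL])
  have usI: "integrable lebesgue us"
    unfolding us_def[abs_def]
    by (rule integrable_lebesgue_on_extend[OF \<Omega>_sets(1) \<Omega>_sets(1) subset_refl L2_integrable[OF wL]])
  have "us \<in> L2_on \<Omega>" unfolding L2_on_eq by (rule L2_lebesgue_onI[OF \<Omega>_sets(1) usL])
  moreover have "weak_L2 \<Omega> (\<lambda>\<epsilon>. zero_ext (- (\<Omega> - \<Omega>e \<epsilon>)) (u \<epsilon>)) us"
  proof -
    have "(LINT x|lebesgue_on \<Omega>. us x * \<phi> x) = (LINT x|lebesgue_on \<Omega>. w x * \<phi> x)" for \<phi>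
      by (intro Bochner_Integration.integral_cong) (auto simp: us_w)
    then show ?thesis using lim by (simp add: weak_L2_def L2_on_eq)
  qed
  \<comment> \<open>In the form given by \<open>fixed\<close>, \<open>w\<close> carries a factor
    \<open>Y\<close>, which is zero a.e. where \<open>X\<close> is.\<close>
  moreover have "AE x in lebesgue. us x = 0" if "AE x in lebesgue. X x = 0"
  proof -
    have "AE x in lebesgue. x \<in> \<Omega> \<longrightarrow> w x = Y x * ((T w x - f x) / max (h Y x) c)"
      using w(1) by (simp add: fixed_def AE_restrict_space_iff)
    with that YX show ?thesis
      by eventually_elim (auto simp: us_def indicator_def)
  qed
  moreover have L: "Lam J \<Omega> X x = h Y x - X x" for x
    by (rule Lam_eq[OF Xm Ym YX _ assms(8)]) (simp add: Y_def)
  have "Lam J \<Omega> X \<in> Linf_on \<Omega>"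
    unfolding Linf_on_def
  proof (intro CollectI conjI exI)
    have [measurable]: "X \<in> borel_measurable (lebesgue_on \<Omega>)" by (rule measurable_restrict_space1[OF Xm])
    have [measurable]: "h Y \<in> borel_measurable (lebesgue_on \<Omega>)" using Y by (intro h_measurable weightD)
    show "Lam J \<Omega> X \<in> borel_measurable (lebesgue_on \<Omega>)" unfolding L[abs_def] by measurable
    show "AE x in lebesgue_on \<Omega>. \<bar>Lam J \<Omega> X x\<bar> \<le> H + 1"
      using YX\<Omega> AE_space
    proof eventually_elim
      case (elim x)
      then show ?case using h_bounds(3)[OF Y, of x] weightD(4)[OF Y, of x] by (simp add: L)
    qed
  qed
  \<comment> \<open>Since \<open>J\<close> has mass one, the nonlocal term is
    \<open>T w x - us x\<close>. The summand \<open>- X x\<close> in \<open>Lam\<close> compensates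
    the resulting \<open>- X x * us x\<close>, which leaves the equation of
    \<open>fixedD\<close>.\<close>
  moreover have "AE x in lebesgue_on \<Omega>.
      X x * f x = X x * (LINT y|lebesgue. J (x - y) * (us y - us x)) - Lam J \<Omega> X x * us x"
    using fixedD[OF Y w(2,1)] YX\<Omega> AE_space
  proof eventually_elim
    case (elim x)
    have "(LINT y|lebesgue. J (x - y) * (us y - us x)) = (LINT y|lebesgue. J (x - y) * us y - us x * J (x - y))"
      by (simp add: right_diff_distrib mult.commute)
    also have "\<dots> = (LINT y|lebesgue. J (x - y) * us y) - us x"
      using J_shift_mult[OF usI] J_shift by simp
    also have "(LINT y|lebesgue. J (x - y) * us y) = T w x"
      unfolding T_def us_def
      by (subst integral_restrict_space) (auto intro!: Bochner_Integration.integral_cong)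
    finally have I: "(LINT y|lebesgue. J (x - y) * (us y - us x)) = T w x - us x" .
    show ?case using elim unfolding I by (simp add: L us_w algebra_simps)
  qed
  ultimately show ?thesis using us_0 by blast
qed

end
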